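(* Let $d\ge 1$ and let $\mathcal K$ be a finite simplicial complex of dimension $d$ equipped with a monotone weight function $w:\mathcal K\to\mathbb R$, and suppose $\beta_{d-1}(\mathcal K)=0$. Let $\mathcal D$ be the multiset of death times in the persistence diagram of $H_{d-1}(\mathcal K)$ with respect to the canonical filtration induced by $w$, and let $\mathcal B$ be the multiset of birth times in the persistence diagram of $H_d(\mathcal K)$ with respect to this filtration. Then, as multisets, $$\mathcal D=\{w(\sigma):\sigma\in M\}\qquad\text{and}\qquad \mathcal B=\{w(\sigma):\sigma\in \mathcal F^d(\mathcal K)\setminus M\},$$ where $M$ is a $d$-dimensional minimal spanning acycle of $\mathcal K$ and $\mathcal F^d(\mathcal K)$ is the set of $d$-faces of $\mathcal K$.
   Context: Fix a field $\mathbb F$. A simplicial complex on a finite vertex set is a collection of nonempty subsets (faces) closed under taking nonempty subsets; a face $\sigma$ has dimension $|\sigma|-1$. $\mathcal F^d(\mathcal K)$ is the set of $d$-faces and $\mathcal K^{d-1}$ is the $(d-1)$-skeleton. $\beta_j(\cdot)$ denotes the rank of the $j$-th reduced simplicial homology $H_j(\cdot)$ with coefficients in $\mathbb F$. Spanning acycles: a set $S\subseteq\mathcal F^d(\mathcal K)$ is a ($d$-)spanning acycle if $\beta_{d-1}(\mathcal K^{d-1}\cup S)=0$ and $\beta_d(\mathcal K^{d-1}\cup S)=0$. A spanning acycle is minimal if it minimizes $w(S)=\sum_{\sigma\in S}w(\sigma)$ over all $d$-spanning acycles. Persistence: $w$ is monotone if $w(\sigma)\le w(\tau)$ whenever $\sigma\subset\tau$.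 Fix a total order $<_l$ on the faces of $\mathcal K$ such that $w(\sigma)<w(\tau)$ implies $\sigma<_l\tau$ and every face is preceded by its proper faces. List the faces as $\sigma_1<_l\dots<_l\sigma_N$ and put $\mathcal K_0=\emptyset$, $\mathcal K_i=\{\sigma_1,\dots,\sigma_i\}$; this one-face-at-a-time filtration is the canonical filtration. The persistence diagram of $H_j(\mathcal K)$ is the multiset of points $(w(\sigma_a),w(\sigma_b))$, one for each interval $[a,b)$ in the barcode of the sequence $H_j(\mathcal K_0)\to H_j(\mathcal K_1)\to\dots\to H_j(\mathcal K_N)$ (second coordinate $+\infty$ if the class never dies); points on the diagonal are retained. Birth times are the first coordinates and death times are the second coordinates, with multiplicity. Equivalently, adding a $d$-face $\sigma_i$ either lowers $\beta_{d-1}$ by one (then $w(\sigma_i)$ is a death time for $H_{d-1}$) or raises $\beta_d$ by one (then $w(\sigma_i)$ is a birth time for $H_d$). *)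

theory Defs
  imports
    Complex_Main
    "HOL-Library.Function_Algebras"
    "HOL-Library.Multiset"
    "HOL-Library.Extended_Nat"
    "HOL-Library.Extended_Real"
begin

section \<open>Simplicial complexes\<close>

definition simplicial_complex :: "'a set set \<Rightarrow> bool" where
  "simplicial_complex K \<longleftrightarrow>
     finite (\<Union>K) \<and> {} \<notin> K \<and> (\<forall>\<sigma>\<in>K. \<forall>\<tau>. \<tau> \<subseteq> \<sigma> \<and> \<tau> \<noteq> {} \<longrightarrow> \<tau> \<in> K)"

definition faces :: "nat \<Rightarrow> 'a set set \<Rightarrow> 'a set set" where
  "faces j K = {\<sigma> \<in> K. card \<sigma> = j + 1}"

definition has_dimension :: "'a set set \<Rightarrow> nat \<Rightarrow> bool" where
  "has_dimension K d \<longleftrightarrow> faces d K \<noteq> {} \<and> (\<forall>\<sigma>\<in>K. card \<sigma> \<le> d + 1)"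

text \<open>The skeleton of faces of dimension at most \<open>d - 1\<close>, that is, with at most \<open>d\<close> vertices.\<close>

definition lower_skeleton :: "nat \<Rightarrow> 'a set set \<Rightarrow> 'a set set" where
  "lower_skeleton d K = {\<sigma> \<in> K. card \<sigma> \<le> d}"


section \<open>Reduced simplicial homology with field coefficients\<close>

text \<open>
  A chain is a coefficient function on vertex sets. The linear order on the vertices serves only
  to orient the faces. The boundary of a vertex is the empty face with coefficient \<open>1\<close>, so
  the \<open>0\<close>-cycles are the kernel of the augmentation and the homology below is the reduced one
  in every degree \<open>j \<ge> 0\<close>.
\<close>

definition chain_scale :: "'f::field \<Rightarrow> ('b \<Rightarrow> 'f) \<Rightarrow> 'b \<Rightarrow> 'f" (infixr \<open>*\<^sub>C\<close> 75) where
  "r *\<^sub>C c = (\<lambda>\<sigma>. r * c \<sigma>)"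

global_interpretation chain: vector_space chain_scale
  by unfold_locales (auto simp: chain_scale_def fun_eq_iff algebra_simps)

definition face_chain :: "'a set \<Rightarrow> 'a set \<Rightarrow> 'f::field" where
  "face_chain \<sigma> = (\<lambda>\<tau>. if \<tau> = \<sigma> then 1 else 0)"

definition face_boundary :: "'a::linorder set \<Rightarrow> 'a set \<Rightarrow> 'f::field" where
  "face_boundary \<sigma> = (\<Sum>v\<in>\<sigma>. (- 1) ^ card {u \<in> \<sigma>. u < v} *\<^sub>C face_chain (\<sigma> - {v}))"

definition boundary :: "('a::linorder set \<Rightarrow> 'f::field) \<Rightarrow> 'a set \<Rightarrow> 'f" where
  "boundary c = (\<Sum>\<sigma> | c \<sigma> \<noteq> 0. c \<sigma> *\<^sub>C face_boundary \<sigma>)"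

definition chains :: "nat \<Rightarrow> 'a set set \<Rightarrow> ('a set \<Rightarrow> 'f::field) set" where
  "chains j K = {c. \<forall>\<sigma>. c \<sigma> \<noteq> 0 \<longrightarrow> \<sigma> \<in> faces j K}"

definition cycles :: "nat \<Rightarrow> 'a::linorder set set \<Rightarrow> ('a set \<Rightarrow> 'f::field) set" where
  "cycles j K = {c \<in> chains j K. boundary c = 0}"

definition boundaries :: "nat \<Rightarrow> 'a::linorder set set \<Rightarrow> ('a set \<Rightarrow> 'f::field) set" where
  "boundaries j K = boundary ` chains (j + 1) K"

text \<open>The rank of the quotient of \<open>cycles j K\<close> by its subspace \<open>boundaries j K\<close>.\<close>

definition betti :: "'f::field itself \<Rightarrow> nat \<Rightarrow> 'a::linorder set set \<Rightarrow> nat" where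
  "betti F j K = chain.dim (cycles j K :: ('a set \<Rightarrow> 'f) set)
                 - chain.dim (boundaries j K :: ('a set \<Rightarrow> 'f) set)"

text \<open>The homology classes of the cycles \<open>z k\<close>, \<open>k \<in> I\<close>, form a basis of the quotient of
  \<open>cycles j K\<close> by \<open>boundaries j K\<close> (as a family: the classes are pairwise distinct).\<close>

definition homology_basis ::
    "nat \<Rightarrow> 'a::linorder set set \<Rightarrow> 'i set \<Rightarrow> ('i \<Rightarrow> 'a set \<Rightarrow> 'f::field) \<Rightarrow> bool" where
  "homology_basis j K I z \<longleftrightarrow>
     finite I \<and>
     (\<forall>k\<in>I. z k \<in> cycles j K) \<and>
     (\<forall>x\<in>cycles j K. \<exists>r. x - (\<Sum>k\<in>I. r k *\<^sub>C z k) \<in> boundaries j K) \<and>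
     (\<forall>r. (\<Sum>k\<in>I. r k *\<^sub>C z k) \<in> boundaries j K \<longrightarrow> (\<forall>k\<in>I. r k = 0))"


section \<open>Spanning acycles\<close>

definition spanning_acycle ::
    "'f::field itself \<Rightarrow> nat \<Rightarrow> 'a::linorder set set \<Rightarrow> 'a set set \<Rightarrow> bool" where
  "spanning_acycle F d K S \<longleftrightarrow>
     S \<subseteq> faces d K \<and>
     betti F (d - 1) (lower_skeleton d K \<union> S) = 0 \<and>
     betti F d (lower_skeleton d K \<union> S) = 0"

definition minimal_spanning_acycle ::
    "'f::field itself \<Rightarrow> nat \<Rightarrow> 'a::linorder set set \<Rightarrow> ('a set \<Rightarrow> real) \<Rightarrow> 'a set set \<Rightarrow> bool" where
  "minimal_spanning_acycle F d K w M \<longleftrightarrow>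
     spanning_acycle F d K M \<and>
     (\<forall>S. spanning_acycle F d K S \<longrightarrow> (\<Sum>\<sigma>\<in>M. w \<sigma>) \<le> (\<Sum>\<sigma>\<in>S. w \<sigma>))"


section \<open>Persistence\<close>

text \<open>A total order on the faces is given by the list of all faces in increasing order.\<close>

definition canonical_order :: "'a set set \<Rightarrow> ('a set \<Rightarrow> real) \<Rightarrow> 'a set list \<Rightarrow> bool" where
  "canonical_order K w L \<longleftrightarrow>
     distinct L \<and> set L = K \<and>
     (\<forall>a < length L. \<forall>b < length L. w (L ! a) < w (L ! b) \<longrightarrow> a < b) \<and>
     (\<forall>a < length L. \<forall>b < length L. L ! a \<subset> L ! b \<longrightarrow> a < b)"

definition filtration :: "'a set list \<Rightarrow> nat \<Rightarrow> 'a set set" where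
  "filtration L i = set (take i L)"

text \<open>
  \<open>is_barcode F j L P\<close>: the persistence module formed by the degree-\<open>j\<close> homology of
  \<open>filtration L 0, \<dots>, filtration L (length L)\<close>, with the maps induced by inclusion, is
  isomorphic to the direct sum of the interval modules \<open>[a, b)\<close>, \<open>(a, b) \<in># P\<close>, where
  \<open>b = \<infinity>\<close> if the class survives to the end. Under such an isomorphism the generator of the
  \<open>k\<close>-th summand at time \<open>a k\<close> is the class of a cycle \<open>z k\<close> of \<open>filtration L (a k)\<close>. Its image
  at a later time is the class of the same cycle there, which has to vanish at time \<open>b k\<close>,
  and at each time the generators of the summands alive then form a basis.
\<close>

definition is_barcode ::
    "'f::field itself \<Rightarrow> nat \<Rightarrow> 'a::linorder set list \<Rightarrow> (nat \<times> enat) multiset \<Rightarrow> bool" where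
  "is_barcode F j L P \<longleftrightarrow>
     (\<exists>(n::nat) (a :: nat \<Rightarrow> nat) (b :: nat \<Rightarrow> enat) (z :: nat \<Rightarrow> 'a set \<Rightarrow> 'f).
        P = image_mset (\<lambda>k. (a k, b k)) (mset_set {..<n}) \<and>
        (\<forall>k<n. a k \<le> length L \<and> enat (a k) < b k \<and> (b k \<le> enat (length L) \<or> b k = \<infinity>)) \<and>
        (\<forall>k<n. z k \<in> cycles j (filtration L (a k))) \<and>
        (\<forall>k<n. \<forall>i. b k = enat i \<longrightarrow> z k \<in> boundaries j (filtration L i)) \<and>
        (\<forall>i\<le>length L.
           homology_basis j (filtration L i) {k. k < n \<and> a k \<le> i \<and> enat i < b k} z))"

text \<open>The face entering at step \<open>i\<close> of the filtration is \<open>L ! (i - 1)\<close>. No interval is born at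
  step \<open>0\<close>, because the empty complex has no homology in degrees \<open>j \<ge> 0\<close>.\<close>

definition entry_weight :: "('a set \<Rightarrow> real) \<Rightarrow> 'a set list \<Rightarrow> nat \<Rightarrow> real" where
  "entry_weight w L i = w (L ! (i - 1))"

definition diagram_point ::
    "('a set \<Rightarrow> real) \<Rightarrow> 'a set list \<Rightarrow> nat \<times> enat \<Rightarrow> real \<times> ereal" where
  "diagram_point w L = (\<lambda>(a, b).
     (entry_weight w L a, case b of enat i \<Rightarrow> ereal (entry_weight w L i) | \<infinity> \<Rightarrow> \<infinity>))"

definition is_persistence_diagram ::
    "'f::field itself \<Rightarrow> nat \<Rightarrow> ('a::linorder set \<Rightarrow> real) \<Rightarrow> 'a set list \<Rightarrow>
     (real \<times> ereal) multiset \<Rightarrow> bool" where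
  "is_persistence_diagram F j w L D \<longleftrightarrow>
     (\<exists>P. is_barcode F j L P \<and> D = image_mset (diagram_point w L) P)"

definition birth_times :: "(real \<times> ereal) multiset \<Rightarrow> real multiset" where
  "birth_times D = image_mset fst D"

definition death_times :: "(real \<times> ereal) multiset \<Rightarrow> ereal multiset" where
  "death_times D = image_mset snd D"

end

theory Submission
  imports Defs
begin

text \<open>
  Since \<open>H\<^bsub>d-1\<^esub>\<close> of the whole complex vanishes, a set of \<open>d\<close>-faces is a spanning acycle exactly
  if the boundaries of its faces form a basis of the span of the boundaries of all \<open>d\<close>-faces
  (\<open>spanning_acycle_iff_basis_family\<close>). Minimal spanning acycles are thus the minimum weight bases
  of a linear matroid.

  Going through the faces in the canonical order, let the greedy acycle collect each \<open>d\<close>-face whose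
  boundary is not spanned by the boundaries of earlier \<open>d\<close>-faces. It is a basis, and so is each
  of its sublevel sets in the \<open>d\<close>-faces of bounded weight, because the order refines the
  weights. By the exchange property a basis of minimum weight has this sublevel property, too.
  Hence both have, for each threshold, equally many elements of weight at most (or below) that
  threshold, and so the same multiset of weights (\<open>weights_eq_of_sublevel_spanning\<close>). It remains to
  compare the barcodes with the greedy acycle, rather than with a minimal spanning acycle.

  When a face of the greedy acycle enters, the class of its boundary, nonzero before, becomes zero,
  and exactly one bar of degree \<open>d - 1\<close> ends. Any other face leaves the space of boundaries of degree
  \<open>d - 1\<close> unchanged, and no bar ends (\<open>death_indices_bij_betw\<close>).
  Dually, a \<open>d\<close>-face outside the greedy acycle lies on a cycle of the faces up to it, and exactly
  one bar of degree \<open>d\<close> starts when it enters; no bar starts at any other face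
  (\<open>birth_indices_bij_betw\<close>). Both bijections follow directly from the fact that the
  representing cycles of the living bars form a basis of homology at each step; dimensions of
  homology groups are not needed.
\<close>

section \<open>Bases of a finite family of vectors\<close>

text \<open>A locale of its own, since the real vector spaces interpret \<^locale>\<open>vector_space\<close>, and
  their copies of the constants below would shadow the local ones.\<close>

locale vector_family = vector_space scale
  for scale :: "'a::field \<Rightarrow> 'b::ab_group_add \<Rightarrow> 'b"
begin

text \<open>The subfamily of \<open>f\<close> indexed by \<open>S\<close> is a basis of the span of the family indexed by \<open>E\<close>.
  Independence is meant for families, so \<open>f\<close> has to be injective on \<open>S\<close>.\<close>

definition basis_family :: "('i \<Rightarrow> 'b) \<Rightarrow> 'i set \<Rightarrow> 'i set \<Rightarrow> bool" where
  "basis_family f E S \<longleftrightarrow>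
     S \<subseteq> E \<and> inj_on f S \<and> independent (f ` S) \<and> f ` E \<subseteq> span (f ` S)"

text \<open>A new element \<open>e\<close> can replace some element of a basis outside \<open>T\<close>, if \<open>T\<close> does not
  already span it.\<close>

lemma basis_family_exchange:
  assumes M: "basis_family f E M" and "finite M" and e: "e \<in> E"
    and T: "T \<subseteq> M" and nT: "f e \<notin> span (f ` T)"
  obtains m where "m \<in> M - T" "e \<notin> M - {m}" "basis_family f E (insert e (M - {m}))"
proof -
  \<comment> \<open>Among the subsets of \<open>M\<close> that contain \<open>T\<close> and span \<open>f e\<close>, take a smallest one \<open>U\<close>: none of
    its elements outside \<open>T\<close> can be spared, so any of them may be exchanged for \<open>e\<close>.\<close>
  define P where "P U \<longleftrightarrow> T \<subseteq> U \<and> U \<subseteq> M \<and> f e \<in> span (f ` U)" for U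
  have "P M"
    using M e T by (auto simp: P_def basis_family_def)
  then obtain U where U: "P U" and Umin: "\<And>V. P V \<Longrightarrow> card U \<le> card V"
    using ex_has_least_nat[of P M card] by blast
  have "U \<noteq> T" using U nT by (auto simp: P_def)
  then obtain m where m: "m \<in> U" "m \<notin> T" using U by (auto simp: P_def)
  have finU: "finite U" using U \<open>finite M\<close> by (auto simp: P_def intro: finite_subset)
  have UM: "U \<subseteq> M" using U by (simp add: P_def)
  have "\<not> P (U - {m})"
    using Umin[of "U - {m}"] m finU by (meson card_Diff1_less leD)
  then have n: "f e \<notin> span (f ` (U - {m}))"
    using U m by (auto simp: P_def)
  have "f e \<in> span (insert (f m) (f ` (U - {m})))"
    using U m by (metis P_def image_insert insert_Diff)
  then have "f m \<in> span (insert (f e) (f ` (U - {m})))"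
    using in_span_insert n by blast
  then have fm: "f m \<in> span (insert (f e) (f ` (M - {m})))"
    by (rule rev_subsetD) (intro span_mono, use UM in auto)
  have indM: "independent (f ` M)" and injM: "inj_on f M" and ME: "M \<subseteq> E"
    and sp: "f ` E \<subseteq> span (f ` M)"
    using M by (auto simp: basis_family_def)
  have mM: "m \<in> M" using m UM by auto
  have im: "f ` M - {f m} = f ` (M - {m})"
    using injM mM by (auto simp: inj_on_def)
  have ne: "f e \<notin> span (f ` (M - {m}))"
  proof
    assume "f e \<in> span (f ` (M - {m}))"
    then have "f m \<in> span (f ` (M - {m}))"
      using fm by (simp add: span_redundant)
    with indM mM im show False
      by (auto simp: dependent_def)
  qed
  then have nim: "f e \<notin> f ` (M - {m})"
    using span_base[of "f e" "f ` (M - {m})"] by auto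
  have 1: "independent (insert (f e) (f ` (M - {m})))"
  proof (rule independent_insertI[OF ne])
    show "independent (f ` (M - {m}))"
      by (rule independent_mono[OF indM]) blast
  qed
  have "f ` M \<subseteq> span (insert (f e) (f ` (M - {m})))"
  proof
    fix y assume "y \<in> f ` M"
    then show "y \<in> span (insert (f e) (f ` (M - {m})))"
      using fm im by (cases "y = f m") (auto intro: span_base)
  qed
  then have 2: "f ` E \<subseteq> span (insert (f e) (f ` (M - {m})))"
    using sp span_minimal[OF _ subspace_span] by blast
  show thesis
  proof (rule that[of m])
    show "m \<in> M - T" using m mM by auto
    show "e \<notin> M - {m}" using nim by auto
    show "basis_family f E (insert e (M - {m}))"
      unfolding basis_family_def
      using 1 2 ME e nim inj_on_subset[OF injM, of "M - {m}"] by (auto simp: inj_on_insert)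
  qed
qed

text \<open>In a basis of minimum weight, each element of the family is spanned by the basis
  elements that are not heavier: otherwise it could replace a heavier one.\<close>

lemma minimal_basis_family_sublevel:
  fixes w :: "'i \<Rightarrow> real"
  assumes M: "basis_family f E M" and "finite M" and e: "e \<in> E"
    and min: "\<And>S. basis_family f E S \<Longrightarrow> (\<Sum>i\<in>M. w i) \<le> (\<Sum>i\<in>S. w i)"
  shows "f e \<in> span (f ` {m \<in> M. w m \<le> w e})"
proof (rule ccontr)
  assume "f e \<notin> span (f ` {m \<in> M. w m \<le> w e})"
  then obtain m where m: "m \<in> M - {m \<in> M. w m \<le> w e}" "e \<notin> M - {m}"
      "basis_family f E (insert e (M - {m}))"
    using basis_family_exchange[OF M \<open>finite M\<close> e, of "{m \<in> M. w m \<le> w e}"] by blast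
  have "(\<Sum>i\<in>M. w i) \<le> (\<Sum>i\<in>insert e (M - {m}). w i)"
    by (rule min) fact
  also have "\<dots> = w e + (\<Sum>i\<in>M - {m}. w i)"
    using m \<open>finite M\<close> by (subst sum.insert) auto
  also have "\<dots> < w m + (\<Sum>i\<in>M - {m}. w i)"
    using m by auto
  also have "\<dots> = (\<Sum>i\<in>M. w i)"
    using m \<open>finite M\<close> by (subst sum.remove[of M m]) auto
  finally show False by simp
qed

text \<open>For a downward closed predicate \<open>P\<close> on weights, the basis elements with weight in \<open>P\<close> are a
  basis of the corresponding part of the family, so their number does not depend on the basis.\<close>

lemma card_sublevel_basis_family:
  fixes w :: "'i \<Rightarrow> real"
  assumes M: "basis_family f E M"
    and sub: "\<And>e. e \<in> E \<Longrightarrow> f e \<in> span (f ` {m \<in> M. w m \<le> w e})"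
    and P: "\<And>x y. P x \<Longrightarrow> y \<le> x \<Longrightarrow> P y"
  shows "card {m \<in> M. P (w m)} = dim (f ` {e \<in> E. P (w e)})"
proof -
  let ?M = "{m \<in> M. P (w m)}" and ?E = "{e \<in> E. P (w e)}"
  have *: "inj_on f ?M" "independent (f ` ?M)" "?M \<subseteq> ?E"
    using M independent_mono[of "f ` M" "f ` ?M"] by (auto simp: basis_family_def inj_on_def)
  have "f ` ?E \<subseteq> span (f ` ?M)"
  proof clarify
    fix e assume e: "e \<in> E" "P (w e)"
    show "f e \<in> span (f ` ?M)"
      by (rule subsetD[OF span_mono sub[OF e(1)]]) (use e P in blast)
  qed
  then have "span (f ` ?M) = span (f ` ?E)"
    using image_mono[OF *(3), of f] span_superset[of "f ` ?E"] by (intro span_eq[THEN iffD2]) blast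
  then have "dim (f ` ?E) = card (f ` ?M)"
    using *(2) by (rule dim_eq_card)
  then show ?thesis
    using *(1) by (simp add: card_image)
qed

lemma weights_eq_of_sublevel_spanning:
  fixes w :: "'i \<Rightarrow> real"
  assumes "finite E"
    and M: "basis_family f E M" "\<And>e. e \<in> E \<Longrightarrow> f e \<in> span (f ` {m \<in> M. w m \<le> w e})"
    and N: "basis_family f E N" "\<And>e. e \<in> E \<Longrightarrow> f e \<in> span (f ` {m \<in> N. w m \<le> w e})"
  shows "image_mset w (mset_set M) = image_mset w (mset_set N)"
proof -
  have fin: "finite M" "finite N"
    using M(1) N(1) \<open>finite E\<close> by (auto simp: basis_family_def intro: finite_subset)
  have cnt: "count (image_mset w (mset_set A)) x = card {a \<in> A. w a \<le> x} - card {a \<in> A. w a < x}"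
    if "finite A" for A x
  proof -
    have "count (image_mset w (mset_set A)) x = card {a \<in> A. w a = x}"
      using that by (simp add: count_image_mset vimage_def Int_def conj_commute)
    also have "{a \<in> A. w a = x} = {a \<in> A. w a \<le> x} - {a \<in> A. w a < x}"
      by auto
    also have "card \<dots> = card {a \<in> A. w a \<le> x} - card {a \<in> A. w a < x}"
      using that by (intro card_Diff_subset) auto
    finally show ?thesis .
  qed
  show ?thesis
  proof (rule multiset_eqI)
    fix x
    have "card {a \<in> M. w a \<le> x} = card {a \<in> N. w a \<le> x}"
      using card_sublevel_basis_family[OF M, of "\<lambda>y. y \<le> x"]
        card_sublevel_basis_family[OF N, of "\<lambda>y. y \<le> x"] by simp
    moreover have "card {a \<in> M. w a < x} = card {a \<in> N. w a < x}"
      using card_sublevel_basis_family[OF M, of "\<lambda>y. y < x"]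
        card_sublevel_basis_family[OF N, of "\<lambda>y. y < x"] by simp
    ultimately show "count (image_mset w (mset_set M)) x = count (image_mset w (mset_set N)) x"
      using fin by (simp add: cnt)
  qed
qed

text \<open>The elements of \<open>E\<close> whose vector is not in the span of those that precede them in the list
  \<open>xs\<close>. Later duplicates of an element are never selected anew, so \<open>xs\<close> need not be distinct.\<close>

definition greedy_basis :: "('i \<Rightarrow> 'b) \<Rightarrow> 'i set \<Rightarrow> 'i list \<Rightarrow> 'i set" where
  "greedy_basis f E xs =
     {xs ! i | i. i < length xs \<and> xs ! i \<in> E \<and> f (xs ! i) \<notin> span (f ` (E \<inter> set (take i xs)))}"

lemma greedy_basis_snoc:
  "greedy_basis f E (xs @ [x]) =
     greedy_basis f E xs \<union> (if x \<in> E \<and> f x \<notin> span (f ` (E \<inter> set xs)) then {x} else {})"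
  (is "?l = ?r")
proof
  show "?l \<subseteq> ?r"
    unfolding greedy_basis_def by (auto simp: nth_append less_Suc_eq)
  show "?r \<subseteq> ?l"
  proof
    fix y assume "y \<in> ?r"
    then consider (a) "y \<in> greedy_basis f E xs"
      | (b) "y = x" "x \<in> E" "f x \<notin> span (f ` (E \<inter> set xs))"
      by (auto split: if_splits)
    then show "y \<in> ?l"
    proof cases
      case a
      then obtain i where "i < length xs" "y = xs ! i" "xs ! i \<in> E"
          "f (xs ! i) \<notin> span (f ` (E \<inter> set (take i xs)))"
        by (auto simp: greedy_basis_def)
      then show ?thesis
        unfolding greedy_basis_def by (auto intro!: exI[of _ i] simp: nth_append)
    next
      case b
      then show ?thesis
        unfolding greedy_basis_def by (auto intro!: exI[of _ "length xs"])
    qed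
  qed
qed

lemma basis_family_greedy_basis: "basis_family f (E \<inter> set xs) (greedy_basis f E xs)"
proof (induction xs rule: rev_induct)
  case Nil
  then show ?case by (simp add: greedy_basis_def basis_family_def independent_empty)
next
  case (snoc x xs)
  let ?G = "greedy_basis f E xs"
  have G: "?G \<subseteq> E \<inter> set xs" "inj_on f ?G" "independent (f ` ?G)"
      "f ` (E \<inter> set xs) \<subseteq> span (f ` ?G)"
    using snoc by (auto simp: basis_family_def)
  have eq: "span (f ` (E \<inter> set xs)) = span (f ` ?G)"
    using G(4) image_mono[OF G(1), of f] span_superset[of "f ` (E \<inter> set xs)"]
    by (intro span_eq[THEN iffD2]) blast
  show ?case
  proof (cases "x \<in> E \<and> f x \<notin> span (f ` (E \<inter> set xs))")
    case True
    then have nx: "f x \<notin> span (f ` ?G)" "x \<in> E" using eq by auto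
    then have "f x \<notin> f ` ?G" using span_base[of "f x" "f ` ?G"] by auto
    moreover have "f ` (E \<inter> set xs) \<subseteq> span (insert (f x) (f ` ?G))"
      using G(4) span_mono[of "f ` ?G" "insert (f x) (f ` ?G)"] by blast
    ultimately show ?thesis
      using G nx True
      by (auto simp: greedy_basis_snoc basis_family_def independent_insert inj_on_insert
          intro: span_base)
  next
    case False
    then have "greedy_basis f E (xs @ [x]) = ?G" by (auto simp: greedy_basis_snoc)
    with False G eq show ?thesis by (auto simp: basis_family_def)
  qed
qed

lemma greedy_basis_take_subset: "greedy_basis f E (take n xs) \<subseteq> greedy_basis f E xs"
  unfolding greedy_basis_def by (auto simp: min_absorb1)

lemma nth_in_span_greedy_basis:
  assumes "i < length xs" "xs ! i \<in> E"
  shows "f (xs ! i) \<in> span (f ` (greedy_basis f E xs \<inter> set (take (Suc i) xs)))"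
proof -
  have b: "basis_family f (E \<inter> set (take (Suc i) xs)) (greedy_basis f E (take (Suc i) xs))"
    by (rule basis_family_greedy_basis)
  have "xs ! i \<in> set (take (Suc i) xs)"
    using assms by (simp add: take_Suc_conv_app_nth)
  then have "f (xs ! i) \<in> span (f ` greedy_basis f E (take (Suc i) xs))"
    using b assms by (auto simp: basis_family_def)
  moreover have "greedy_basis f E (take (Suc i) xs) \<subseteq> greedy_basis f E xs \<inter> set (take (Suc i) xs)"
    using b greedy_basis_take_subset[of f E "Suc i" xs] by (auto simp: basis_family_def)
  ultimately show ?thesis
    by (meson image_mono span_mono subsetD)
qed

lemma nth_in_greedy_basis_iff:
  assumes "distinct xs" "i < length xs"
  shows "xs ! i \<in> greedy_basis f E xs \<longleftrightarrow>
     xs ! i \<in> E \<and> f (xs ! i) \<notin> span (f ` (E \<inter> set (take i xs)))"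
  unfolding greedy_basis_def using assms by (auto simp: nth_eq_iff_index_eq)

text \<open>Linear independence of a finite family, expressed through its linear relations.\<close>

lemma independent_family_iff:
  assumes "finite S"
  shows "inj_on f S \<and> independent (f ` S) \<longleftrightarrow>
     (\<forall>r. (\<Sum>k\<in>S. scale (r k) (f k)) = 0 \<longrightarrow> (\<forall>k\<in>S. r k = 0))"
proof (intro iffI conjI allI impI ballI)
  fix r k
  assume "inj_on f S \<and> independent (f ` S)" and 0: "(\<Sum>k\<in>S. scale (r k) (f k)) = 0" and k: "k \<in> S"
  then have inj: "inj_on f S" and ind: "independent (f ` S)" by auto
  define u where "u = r \<circ> inv_into S f"
  have "(\<Sum>v\<in>f ` S. scale (u v) v) = (\<Sum>k\<in>S. scale (r k) (f k))"
    using inj by (simp add: sum.reindex u_def)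
  then have "\<forall>v\<in>f ` S. u v = 0"
    using ind 0 assms dependent_finite[of "f ` S"] by auto
  then show "r k = 0" using k inj by (auto simp: u_def)
next
  assume r: "\<forall>r. (\<Sum>k\<in>S. scale (r k) (f k)) = 0 \<longrightarrow> (\<forall>k\<in>S. r k = 0)"
  show inj: "inj_on f S"
  proof (rule inj_onI, rule ccontr)
    fix x y assume xy: "x \<in> S" "y \<in> S" "f x = f y" "x \<noteq> y"
    \<comment> \<open>Equal vectors at different indices satisfy the relation with coefficients \<open>1\<close> and \<open>- 1\<close>.\<close>
    define s where "s k = (if k = x then 1 else if k = y then - 1 else 0 :: 'a)" for k
    have "(\<Sum>k\<in>S. scale (s k) (f k)) = (\<Sum>k\<in>{x, y}. scale (s k) (f k))"
      using assms xy by (intro sum.mono_neutral_right) (auto simp: s_def)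
    also have "\<dots> = 0" using xy by (simp add: s_def)
    finally have "s x = 0" using r xy by blast
    then show False by (simp add: s_def)
  qed
  show "independent (f ` S)"
  proof
    assume "dependent (f ` S)"
    then obtain u where u: "\<exists>v\<in>f ` S. u v \<noteq> 0" "(\<Sum>v\<in>f ` S. scale (u v) v) = 0"
      using assms dependent_finite[of "f ` S"] by auto
    then show False using r inj by (auto simp: sum.reindex)
  qed
qed

text \<open>The ambient space may be infinite-dimensional; the finite set \<open>B\<close> bounds \<open>W\<close>.\<close>

lemma subspace_eq_if_dim_le:
  assumes U: "subspace U" and W: "subspace W" and UW: "U \<subseteq> W"
    and B: "finite B" "W \<subseteq> span B" and d: "dim W \<le> dim U"
  shows "U = W"
proof -
  obtain C where C: "C \<subseteq> U" "independent C" "U \<subseteq> span C" "card C = dim U"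
    using basis_exists by blast
  obtain D where D: "C \<subseteq> D" "D \<subseteq> W" "independent D" "W \<subseteq> span D"
    using maximal_independent_subset_extend[of C W] C UW by blast
  have "finite D" using independent_span_bound[OF B(1) D(3)] D B by auto
  moreover have "card D = dim W"
    using D basis_card_eq_dim[OF D(2,4,3)] by simp
  ultimately have "C = D"
    using d C D by (intro card_seteq) auto
  then have "W \<subseteq> U" using D(4) C(1) U span_minimal by blast
  with UW show ?thesis by auto
qed

end

global_interpretation chain: vector_family chain_scale ..


section \<open>Simplicial chains\<close>

lemma chain_sum_apply: "(\<Sum>i\<in>I. g i) x = (\<Sum>i\<in>I. g i x :: 'f::comm_monoid_add)"
  by (induction I rule: infinite_finite_induct) auto

lemma boundary_eq_sum:
  fixes c :: "'a::linorder set \<Rightarrow> 'f::field"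
  assumes "finite A" "{\<sigma>. c \<sigma> \<noteq> 0} \<subseteq> A"
  shows "boundary c = (\<Sum>\<sigma>\<in>A. c \<sigma> *\<^sub>C face_boundary \<sigma>)"
  unfolding boundary_def using assms by (intro sum.mono_neutral_left) auto

lemma boundary_face_chain: "boundary (face_chain \<sigma>) = (face_boundary \<sigma> :: 'a::linorder set \<Rightarrow> 'f::field)"
  by (subst boundary_eq_sum[of "{\<sigma>}"]) (auto simp: face_chain_def split: if_splits)

lemma boundary_scale:
  fixes c :: "'a::linorder set \<Rightarrow> 'f::field"
  assumes "finite {\<sigma>. c \<sigma> \<noteq> 0}"
  shows "boundary (r *\<^sub>C c) = r *\<^sub>C boundary c"
proof -
  have "boundary (r *\<^sub>C c) = (\<Sum>\<sigma> | c \<sigma> \<noteq> 0. (r *\<^sub>C c) \<sigma> *\<^sub>C face_boundary \<sigma>)"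
    by (intro boundary_eq_sum assms) (auto simp: chain_scale_def)
  also have "\<dots> = r *\<^sub>C boundary c"
    by (simp add: boundary_def chain.scale_sum_right) (simp add: chain_scale_def)
  finally show ?thesis .
qed

lemma boundary_add:
  fixes c c' :: "'a::linorder set \<Rightarrow> 'f::field"
  assumes "finite {\<sigma>. c \<sigma> \<noteq> 0}" "finite {\<sigma>. c' \<sigma> \<noteq> 0}"
  shows "boundary (c + c') = boundary c + boundary c'"
proof -
  let ?A = "{\<sigma>. c \<sigma> \<noteq> 0} \<union> {\<sigma>. c' \<sigma> \<noteq> 0}"
  have 1: "boundary (c + c') = (\<Sum>\<sigma>\<in>?A. (c + c') \<sigma> *\<^sub>C face_boundary \<sigma>)"
    by (intro boundary_eq_sum) (use assms in auto)
  have 2: "boundary c = (\<Sum>\<sigma>\<in>?A. c \<sigma> *\<^sub>C face_boundary \<sigma>)"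
    by (intro boundary_eq_sum) (use assms in auto)
  have 3: "boundary c' = (\<Sum>\<sigma>\<in>?A. c' \<sigma> *\<^sub>C face_boundary \<sigma>)"
    by (intro boundary_eq_sum) (use assms in auto)
  show ?thesis
    unfolding 1 2 3 by (simp add: chain.scale_left_distrib sum.distrib)
qed

lemma finite_support_sum:
  fixes g :: "'i \<Rightarrow> 'b \<Rightarrow> 'f::comm_monoid_add"
  assumes "\<And>i. i \<in> I \<Longrightarrow> finite {\<sigma>. g i \<sigma> \<noteq> 0}" "finite I"
  shows "finite {\<sigma>. (\<Sum>i\<in>I. g i) \<sigma> \<noteq> 0}"
proof (rule finite_subset)
  show "{\<sigma>. (\<Sum>i\<in>I. g i) \<sigma> \<noteq> 0} \<subseteq> (\<Union>i\<in>I. {\<sigma>. g i \<sigma> \<noteq> 0})"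
    by (auto simp: chain_sum_apply intro: sum.not_neutral_contains_not_neutral)
qed (use assms in auto)

lemma boundary_sum:
  fixes g :: "'i \<Rightarrow> 'a::linorder set \<Rightarrow> 'f::field"
  assumes "finite I" "\<And>i. i \<in> I \<Longrightarrow> finite {\<sigma>. g i \<sigma> \<noteq> 0}"
  shows "boundary (\<Sum>i\<in>I. g i) = (\<Sum>i\<in>I. boundary (g i))"
  using assms
proof (induction I)
  case empty
  then show ?case by (simp add: boundary_def)
next
  case (insert i I)
  then have "finite {\<sigma>. (\<Sum>i\<in>I. g i) \<sigma> \<noteq> 0}" by (intro finite_support_sum) auto
  then have "boundary (g i + (\<Sum>i\<in>I. g i)) = boundary (g i) + boundary (\<Sum>i\<in>I. g i)"
    using insert.prems by (intro boundary_add) auto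
  moreover have "boundary (\<Sum>i\<in>I. g i) = (\<Sum>i\<in>I. boundary (g i))"
    using insert by blast
  ultimately show ?case
    by (simp only: sum.insert[OF insert.hyps])
qed

lemma face_boundary_support:
  assumes "face_boundary \<sigma> \<tau> \<noteq> (0::'f::field)"
  obtains v where "v \<in> \<sigma>" "\<tau> = \<sigma> - {v}"
proof -
  have "(\<Sum>v\<in>\<sigma>. ((- 1) ^ card {u \<in> \<sigma>. u < v} *\<^sub>C face_chain (\<sigma> - {v})) \<tau>) \<noteq> (0::'f)"
    using assms by (simp add: face_boundary_def chain_sum_apply)
  then obtain v where "v \<in> \<sigma>" "((- 1) ^ card {u \<in> \<sigma>. u < v} *\<^sub>C face_chain (\<sigma> - {v})) \<tau> \<noteq> (0::'f)"
    by (meson sum.not_neutral_contains_not_neutral)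
  then show thesis using that[of v]
    by (auto simp: chain_scale_def face_chain_def split: if_splits)
qed

text \<open>The boundary of a boundary is zero: removing \<open>v\<close> and then \<open>u\<close> gives the same face as
  the other way round, with the opposite sign.\<close>

lemma boundary_face_boundary:
  fixes \<sigma> :: "'a::linorder set"
  assumes fin: "finite \<sigma>"
  shows "boundary (face_boundary \<sigma> :: 'a set \<Rightarrow> 'f::field) = 0"
proof -
  define s where "s A v = ((- 1) ^ card {u \<in> A. u < v} :: 'f)" for A and v :: 'a
  define g where "g v u = (s \<sigma> v * s (\<sigma> - {v}) u) *\<^sub>C (face_chain (\<sigma> - {v} - {u}) :: 'a set \<Rightarrow> 'f)"
    for v u
  have anti: "g v u = - g u v" if "u < v" "u \<in> \<sigma>" "v \<in> \<sigma>" for u v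
  proof -
    have "{x \<in> \<sigma> - {v}. x < u} = {x \<in> \<sigma>. x < u}" using that by auto
    then have 1: "s (\<sigma> - {v}) u = s \<sigma> u" by (simp add: s_def)
    have "{x \<in> \<sigma>. x < v} = insert u {x \<in> \<sigma> - {u}. x < v}" using that by auto
    then have "card {x \<in> \<sigma>. x < v} = Suc (card {x \<in> \<sigma> - {u}. x < v})"
      using fin by simp
    then have 2: "s \<sigma> v = - s (\<sigma> - {u}) v" by (simp add: s_def)
    have "\<sigma> - {v} - {u} = \<sigma> - {u} - {v}" by auto
    then show ?thesis
      unfolding g_def 1 2 by (simp add: chain_scale_def fun_eq_iff mult.commute)
  qed
  have fc: "finite {\<tau>. (face_chain \<rho> :: 'a set \<Rightarrow> 'f) \<tau> \<noteq> 0}" for \<rho>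
    by (rule finite_subset[of _ "{\<rho>}"]) (auto simp: face_chain_def split: if_splits)
  then have fsc: "finite {\<tau>. (r *\<^sub>C (face_chain \<rho> :: 'a set \<Rightarrow> 'f)) \<tau> \<noteq> 0}" for r \<rho>
    by (rule finite_subset[rotated]) (auto simp: chain_scale_def)
  have "boundary (face_boundary \<sigma> :: 'a set \<Rightarrow> 'f) =
      (\<Sum>v\<in>\<sigma>. s \<sigma> v *\<^sub>C (face_boundary (\<sigma> - {v}) :: 'a set \<Rightarrow> 'f))"
    unfolding face_boundary_def[of \<sigma>] s_def
    by (simp only: boundary_sum[OF fin fsc] boundary_scale[OF fc] boundary_face_chain)
  also have "\<dots> = (\<Sum>v\<in>\<sigma>. \<Sum>u\<in>\<sigma> - {v}. g v u)"
    by (simp add: face_boundary_def chain.scale_sum_right g_def s_def)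
  \<comment> \<open>In characteristic \<open>2\<close> it would not suffice that the sum equals its negative. Hence the terms
    with \<open>u < v\<close> are cancelled against those with \<open>v < u\<close>.\<close>
  also have "\<dots> = (\<Sum>v\<in>\<sigma>. (\<Sum>u | u \<in> \<sigma> \<and> u < v. g v u) + (\<Sum>u | u \<in> \<sigma> \<and> v < u. g v u))"
  proof (rule sum.cong[OF refl])
    fix v assume "v \<in> \<sigma>"
    have decomp: "\<sigma> - {v} = {u. u \<in> \<sigma> \<and> u < v} \<union> {u. u \<in> \<sigma> \<and> v < u}" by auto
    show "(\<Sum>u\<in>\<sigma> - {v}. g v u) =
        (\<Sum>u | u \<in> \<sigma> \<and> u < v. g v u) + (\<Sum>u | u \<in> \<sigma> \<and> v < u. g v u)"
      unfolding decomp by (rule sum.union_disjoint) (use fin in auto)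
  qed
  also have "\<dots> = (\<Sum>v\<in>\<sigma>. \<Sum>u | u \<in> \<sigma> \<and> u < v. g v u) + (\<Sum>v\<in>\<sigma>. \<Sum>u | u \<in> \<sigma> \<and> v < u. g v u)"
    by (simp add: sum.distrib)
  also have "(\<Sum>v\<in>\<sigma>. \<Sum>u | u \<in> \<sigma> \<and> v < u. g v u) = (\<Sum>v\<in>\<sigma>. \<Sum>u | u \<in> \<sigma> \<and> u < v. g u v)"
    using sum.swap_restrict[OF fin fin] by simp
  also have "(\<Sum>v\<in>\<sigma>. \<Sum>u | u \<in> \<sigma> \<and> u < v. g v u) = (\<Sum>v\<in>\<sigma>. \<Sum>u | u \<in> \<sigma> \<and> u < v. - g u v)"
    using anti by (intro sum.cong refl) auto
  finally show ?thesis by (simp add: sum_negf fun_eq_iff)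
qed

lemma finite_faces: "finite X \<Longrightarrow> finite (faces j X)"
  by (simp add: faces_def)

lemma finite_simplicial_complex: "simplicial_complex K \<Longrightarrow> finite K"
  unfolding simplicial_complex_def using finite_UnionD by blast

lemma chains_finite_support: "finite X \<Longrightarrow> c \<in> chains j X \<Longrightarrow> finite {\<sigma>. c \<sigma> \<noteq> 0}"
  by (rule finite_subset[of _ "faces j X"]) (auto simp: chains_def finite_faces)

lemma boundary_chain:
  "finite X \<Longrightarrow> c \<in> chains j X \<Longrightarrow> boundary c = (\<Sum>\<sigma>\<in>faces j X. c \<sigma> *\<^sub>C face_boundary \<sigma>)"
  by (rule boundary_eq_sum) (auto simp: chains_def finite_faces)

lemma subspace_chains: "chain.subspace (chains j X)"
  by (rule chain.subspaceI) (force simp: chains_def chain_scale_def)+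

lemma subspace_cycles: "finite X \<Longrightarrow> chain.subspace (cycles j X)"
  unfolding cycles_def
  by (rule chain.subspaceI)
    (auto simp: chain.subspace_0 chain.subspace_add chain.subspace_scale subspace_chains
      boundary_add boundary_scale chains_finite_support, simp add: boundary_def)

lemma boundaries_eq_span:
  fixes X :: "'a::linorder set set"
  assumes X: "finite X"
  shows "(boundaries j X :: ('a set \<Rightarrow> 'f::field) set) = chain.span (face_boundary ` faces (j + 1) X)"
proof
  show "(boundaries j X :: ('a set \<Rightarrow> 'f) set) \<subseteq> chain.span (face_boundary ` faces (j + 1) X)"
  proof
    fix x :: "'a set \<Rightarrow> 'f" assume "x \<in> boundaries j X"
    then obtain c where "c \<in> chains (j + 1) X" "x = boundary c"
      by (auto simp: boundaries_def)
    then show "x \<in> chain.span (face_boundary ` faces (j + 1) X)"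
      by (simp only: boundary_chain[OF X])
        (intro chain.span_sum chain.span_scale chain.span_base imageI)
  qed
  have "chain.subspace (boundaries j X :: ('a set \<Rightarrow> 'f) set)"
  proof (rule chain.subspaceI)
    show "(0 :: 'a set \<Rightarrow> 'f) \<in> boundaries j X"
      unfolding boundaries_def
      by (rule image_eqI[of _ _ 0]) (auto simp: boundary_def chain.subspace_0 subspace_chains)
  next
    fix x y :: "'a set \<Rightarrow> 'f" assume "x \<in> boundaries j X" "y \<in> boundaries j X"
    then obtain c c' where "c \<in> chains (j + 1) X" "x = boundary c" "c' \<in> chains (j + 1) X" "y = boundary c'"
      by (auto simp: boundaries_def)
    then show "x + y \<in> boundaries j X"
      unfolding boundaries_def using X
      by (intro image_eqI[of _ _ "c + c'"])
        (auto simp: boundary_add chains_finite_support chain.subspace_add subspace_chains)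
  next
    fix r and x :: "'a set \<Rightarrow> 'f" assume "x \<in> boundaries j X"
    then obtain c where "c \<in> chains (j + 1) X" "x = boundary c"
      by (auto simp: boundaries_def)
    then show "r *\<^sub>C x \<in> boundaries j X"
      unfolding boundaries_def using X
      by (intro image_eqI[of _ _ "r *\<^sub>C c"])
        (auto simp: boundary_scale chains_finite_support chain.subspace_scale subspace_chains)
  qed
  moreover have "face_boundary ` faces (j + 1) X \<subseteq> (boundaries j X :: ('a set \<Rightarrow> 'f) set)"
    unfolding boundaries_def chains_def
    by (intro image_subsetI image_eqI[where f = boundary, OF boundary_face_chain[symmetric]])
      (auto simp: face_chain_def split: if_splits)
  ultimately show "chain.span (face_boundary ` faces (j + 1) X) \<subseteq> (boundaries j X :: ('a set \<Rightarrow> 'f) set)"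
    by (intro chain.span_minimal)
qed

lemma subspace_boundaries: "finite X \<Longrightarrow> chain.subspace (boundaries j X)"
  by (simp add: boundaries_eq_span)

lemma face_boundary_in_cycles:
  fixes \<sigma> :: "'a::linorder set"
  assumes c: "card \<sigma> = j + 2" and X: "\<And>v. v \<in> \<sigma> \<Longrightarrow> \<sigma> - {v} \<in> X"
  shows "(face_boundary \<sigma> :: 'a set \<Rightarrow> 'f::field) \<in> cycles j X"
proof -
  have fin: "finite \<sigma>" using c card_gt_0_iff[of \<sigma>] by auto
  have "(face_boundary \<sigma> :: 'a set \<Rightarrow> 'f) \<in> chains j X"
    unfolding chains_def faces_def
    using c X fin by (auto elim!: face_boundary_support)
  then show ?thesis
    using boundary_face_boundary[OF fin] by (auto simp: cycles_def)
qed

lemma facet_in_complex: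
  assumes "simplicial_complex X" "\<sigma> \<in> faces (j + 1) X" "v \<in> \<sigma>"
  shows "\<sigma> - {v} \<in> X"
proof -
  have "card \<sigma> = j + 2" using assms by (simp add: faces_def)
  then have "card (\<sigma> - {v}) = j + 1" using assms(3) by simp
  then have "\<sigma> - {v} \<noteq> {}" by (metis add_is_0 card.empty one_neq_zero)
  moreover have "\<sigma> \<in> X" using assms(2) by (simp add: faces_def)
  ultimately show ?thesis using assms(1) by (metis Diff_subset simplicial_complex_def)
qed

lemma boundaries_subset_cycles:
  assumes "simplicial_complex X"
  shows "boundaries j X \<subseteq> cycles j X"
  unfolding boundaries_eq_span[OF finite_simplicial_complex[OF assms]]
proof (rule chain.span_minimal)
  show "face_boundary ` faces (j + 1) X \<subseteq> cycles j X"
    using facet_in_complex[OF assms]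
    by (auto intro!: face_boundary_in_cycles) (auto simp: faces_def)
qed (rule subspace_cycles[OF finite_simplicial_complex[OF assms]])

lemma chains_subset_span:
  assumes "finite X"
  shows "chains j X \<subseteq> chain.span (face_chain ` faces j X)"
proof
  fix c :: "'a set \<Rightarrow> 'f::field" assume c: "c \<in> chains j X"
  have "c = (\<Sum>\<sigma>\<in>faces j X. c \<sigma> *\<^sub>C face_chain \<sigma>)"
  proof
    fix \<tau>
    have "(\<Sum>\<sigma>\<in>faces j X. c \<sigma> *\<^sub>C face_chain \<sigma>) \<tau> = (\<Sum>\<sigma>\<in>faces j X. if \<sigma> = \<tau> then c \<sigma> else 0)"
      by (auto simp: chain_sum_apply chain_scale_def face_chain_def intro!: sum.cong)
    also have "\<dots> = c \<tau>"
      using c finite_faces[OF assms, of j] by (auto simp: chains_def)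
    finally show "c \<tau> = (\<Sum>\<sigma>\<in>faces j X. c \<sigma> *\<^sub>C face_chain \<sigma>) \<tau>" by simp
  qed
  then show "c \<in> chain.span (face_chain ` faces j X)"
    by (metis (no_types, lifting) chain.span_sum chain.span_scale chain.span_base imageI)
qed

text \<open>As \<^const>\<open>betti\<close> is a truncated difference of dimensions, its vanishing alone only bounds one
  dimension by the other; the spaces coincide because boundaries are cycles.\<close>

lemma betti_eq_0_iff:
  fixes X :: "'a::linorder set set"
  assumes X: "simplicial_complex X"
  shows "betti TYPE('f::field) j X = 0 \<longleftrightarrow> (boundaries j X :: ('a set \<Rightarrow> 'f) set) = cycles j X"
proof
  let ?Z = "cycles j X :: ('a set \<Rightarrow> 'f) set" and ?B = "boundaries j X :: ('a set \<Rightarrow> 'f) set"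
  have fin: "finite X" by (rule finite_simplicial_complex[OF X])
  assume "betti TYPE('f) j X = 0"
  then have "chain.dim ?Z \<le> chain.dim ?B" by (simp add: betti_def)
  moreover have "?Z \<subseteq> chain.span (face_chain ` faces j X)"
    using chains_subset_span[OF fin] by (auto simp: cycles_def)
  ultimately show "?B = ?Z"
    using subspace_boundaries[OF fin] subspace_cycles[OF fin] boundaries_subset_cycles[OF X]
      finite_faces[OF fin]
    by (intro chain.subspace_eq_if_dim_le[where B = "face_chain ` faces j X"] finite_imageI)
qed (simp add: betti_def)


section \<open>Spanning acycles are bases\<close>

lemma faces_filtration: "faces j (filtration L i) = faces j (set L) \<inter> set (take i L)"
  unfolding faces_def filtration_def using set_take_subset by fastforce

text \<open>A nonzero cycle is a linear relation between the boundaries of the faces.\<close>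

lemma cycles_0_iff_independent:
  fixes X :: "'a::linorder set set"
  assumes "finite X"
  shows "(cycles j X :: ('a set \<Rightarrow> 'f::field) set) = {0} \<longleftrightarrow>
    inj_on (face_boundary :: 'a set \<Rightarrow> 'a set \<Rightarrow> 'f) (faces j X) \<and>
    chain.independent ((face_boundary :: 'a set \<Rightarrow> 'a set \<Rightarrow> 'f) ` faces j X)"
  unfolding chain.independent_family_iff[OF finite_faces[OF assms]]
proof (intro iffI allI impI ballI)
  fix r :: "'a set \<Rightarrow> 'f" and \<sigma>
  assume Z: "(cycles j X :: ('a set \<Rightarrow> 'f) set) = {0}" and \<sigma>: "\<sigma> \<in> faces j X"
    and 0: "(\<Sum>k\<in>faces j X. r k *\<^sub>C (face_boundary k :: 'a set \<Rightarrow> 'f)) = 0"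
  define c where "c \<tau> = (if \<tau> \<in> faces j X then r \<tau> else 0)" for \<tau>
  have c: "c \<in> chains j X" by (simp add: chains_def c_def)
  have "boundary c = (\<Sum>k\<in>faces j X. r k *\<^sub>C (face_boundary k :: 'a set \<Rightarrow> 'f))"
    unfolding boundary_chain[OF assms c] by (intro sum.cong) (auto simp: c_def)
  then have "c \<in> cycles j X" using c 0 by (simp add: cycles_def)
  then have "c \<sigma> = 0" using Z by simp
  then show "r \<sigma> = 0" using \<sigma> by (simp add: c_def)
next
  assume I: "\<forall>r. (\<Sum>k\<in>faces j X. r k *\<^sub>C (face_boundary k :: 'a set \<Rightarrow> 'f)) = 0 \<longrightarrow>
      (\<forall>k\<in>faces j X. r k = 0)"
  have "c = 0" if c: "c \<in> cycles j X" for c :: "'a set \<Rightarrow> 'f"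
  proof
    fix \<sigma>
    have c': "c \<in> chains j X" "boundary c = 0" using c by (auto simp: cycles_def)
    have "\<forall>k\<in>faces j X. c k = 0"
      by (rule I[THEN spec, THEN mp]) (use boundary_chain[OF assms c'(1)] c'(2) in simp)
    then have "c \<sigma> = 0" using c'(1) unfolding chains_def by blast
    then show "c \<sigma> = 0 \<sigma>" by simp
  qed
  moreover have "(0 :: 'a set \<Rightarrow> 'f) \<in> cycles j X"
    using chain.subspace_0[OF subspace_cycles[OF assms]] .
  ultimately show "(cycles j X :: ('a set \<Rightarrow> 'f) set) = {0}" by blast
qed

lemma cycles_cong: "faces j X = faces j Y \<Longrightarrow> cycles j X = cycles j Y"
  by (simp add: cycles_def chains_def)

lemma boundaries_cong: "faces (j + 1) X = faces (j + 1) Y \<Longrightarrow> boundaries j X = boundaries j Y"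
  by (simp add: boundaries_def chains_def)

lemma spanning_acycle_iff_basis_family:
  fixes K :: "'a::linorder set set"
  assumes K: "simplicial_complex K" and "d \<ge> 1" and "betti TYPE('f::field) (d - 1) K = 0"
  shows "spanning_acycle TYPE('f) d K S \<longleftrightarrow>
    chain.basis_family (face_boundary :: 'a set \<Rightarrow> 'a set \<Rightarrow> 'f) (faces d K) S"
proof (cases "S \<subseteq> faces d K")
  case False
  then show ?thesis by (simp add: spanning_acycle_def chain.basis_family_def)
next
  case S: True
  let ?X = "lower_skeleton d K \<union> S"
  let ?f = "face_boundary :: 'a set \<Rightarrow> 'a set \<Rightarrow> 'f"
  have XK: "?X \<subseteq> K" using S by (auto simp: lower_skeleton_def faces_def)
  have X: "simplicial_complex ?X"
    unfolding simplicial_complex_def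
  proof (intro conjI ballI allI impI)
    have "\<Union> ?X \<subseteq> \<Union> K" using XK by blast
    then show "finite (\<Union> ?X)"
      using K by (intro finite_subset[of "\<Union> ?X" "\<Union> K"]) (auto simp: simplicial_complex_def)
    show "{} \<notin> ?X" using K XK by (auto simp: simplicial_complex_def)
    fix \<sigma> \<tau> assume \<sigma>: "\<sigma> \<in> ?X" and \<tau>: "\<tau> \<subseteq> \<sigma> \<and> \<tau> \<noteq> {}"
    have fin: "finite \<sigma>"
      using K \<sigma> XK finite_subset[of \<sigma> "\<Union>K"] by (auto simp: simplicial_complex_def)
    have "\<tau> \<in> K" using K \<sigma> \<tau> XK unfolding simplicial_complex_def by blast
    moreover have "card \<sigma> \<le> d + 1"
      using \<sigma> S by (auto simp: lower_skeleton_def faces_def)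
    moreover have "card \<tau> < card \<sigma>" if "\<tau> \<noteq> \<sigma>"
      using that \<tau> fin by (intro psubset_card_mono) auto
    ultimately show "\<tau> \<in> ?X"
      using \<sigma> by (cases "\<tau> = \<sigma>") (auto simp: lower_skeleton_def)
  qed
  note finX = finite_simplicial_complex[OF X] and finK = finite_simplicial_complex[OF K]
  have faces: "faces d ?X = S" "faces (d + 1) ?X = {}" "faces (d - 1) ?X = faces (d - 1) K"
    using S \<open>d \<ge> 1\<close> by (auto simp: faces_def lower_skeleton_def)
  have d: "d - 1 + 1 = d" using \<open>d \<ge> 1\<close> by simp
  have "(boundaries d ?X :: ('a set \<Rightarrow> 'f) set) = {0}"
    unfolding boundaries_eq_span[OF finX] faces by simp
  then have top: "betti TYPE('f) d ?X = 0 \<longleftrightarrow> inj_on ?f S \<and> chain.independent (?f ` S)"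
    using cycles_0_iff_independent[OF finX, where j = d and 'f = 'f]
    unfolding betti_eq_0_iff[OF X] faces by metis
  have "(cycles (d - 1) ?X :: ('a set \<Rightarrow> 'f) set) = cycles (d - 1) K"
    by (rule cycles_cong) (rule faces)
  also have "\<dots> = boundaries (d - 1) K"
    using assms(3) by (simp add: betti_eq_0_iff[OF K])
  also have "\<dots> = chain.span (?f ` faces d K)"
    by (simp only: boundaries_eq_span[OF finK] d)
  finally have "betti TYPE('f) (d - 1) ?X = 0 \<longleftrightarrow>
      chain.span (?f ` S) = chain.span (?f ` faces d K)"
    by (simp only: betti_eq_0_iff[OF X] boundaries_eq_span[OF finX] d faces)
  also have "\<dots> \<longleftrightarrow> ?f ` faces d K \<subseteq> chain.span (?f ` S)"
  proof -
    have "?f ` S \<subseteq> chain.span (?f ` faces d K)"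
      using S chain.span_superset[of "?f ` faces d K"] by blast
    then show ?thesis unfolding chain.span_eq by blast
  qed
  finally show ?thesis
    using S top by (auto simp: spanning_acycle_def chain.basis_family_def)
qed


section \<open>Births and deaths in the canonical filtration\<close>

text \<open>The \<open>d\<close>-faces whose boundary is not spanned by the boundaries of the \<open>d\<close>-faces that enter
  the filtration before them.\<close>

definition greedy_acycle :: "'f::field itself \<Rightarrow> nat \<Rightarrow> 'a::linorder set list \<Rightarrow> 'a set set" where
  "greedy_acycle F d L =
     chain.greedy_basis (face_boundary :: 'a set \<Rightarrow> 'a set \<Rightarrow> 'f) (faces d (set L)) L"

lemma nth_in_greedy_acycle_iff:
  fixes L :: "'a::linorder set list"
  assumes "distinct L" "i < length L"
  shows "L ! i \<in> greedy_acycle TYPE('f::field) (j + 1) L \<longleftrightarrow>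
    card (L ! i) = j + 2 \<and>
    (face_boundary (L ! i) :: 'a set \<Rightarrow> 'f) \<notin> boundaries j (filtration L i)"
proof -
  have "finite (filtration L i)" by (simp add: filtration_def)
  moreover have "L ! i \<in> faces (j + 1) (set L) \<longleftrightarrow> card (L ! i) = j + 2"
    using assms by (simp add: faces_def)
  ultimately show ?thesis
    unfolding greedy_acycle_def chain.nth_in_greedy_basis_iff[OF assms]
    by (simp add: boundaries_eq_span faces_filtration)
qed

lemma filtration_Suc: "i < length L \<Longrightarrow> filtration L (Suc i) = insert (L ! i) (filtration L i)"
  by (simp add: filtration_def take_Suc_conv_app_nth)

lemma faces_filtration_Suc:
  "i < length L \<Longrightarrow> faces j (filtration L (Suc i)) =
    (if card (L ! i) = j + 1 then insert (L ! i) (faces j (filtration L i)) else faces j (filtration L i))"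
  by (auto simp: filtration_Suc faces_def)

lemma finite_filtration [simp]: "finite (filtration L i)"
  by (simp add: filtration_def)

lemma filtration_mono: "i \<le> i' \<Longrightarrow> filtration L i \<subseteq> filtration L i'"
  by (simp add: filtration_def set_take_subset_set_take)

lemma chains_mono: "X \<subseteq> Y \<Longrightarrow> chains j X \<subseteq> chains j Y"
  by (auto simp: chains_def faces_def)

lemma boundaries_mono: "X \<subseteq> Y \<Longrightarrow> boundaries j X \<subseteq> boundaries j Y"
  unfolding boundaries_def by (intro image_mono chains_mono)

lemma nth_notin_filtration: "distinct L \<Longrightarrow> i < length L \<Longrightarrow> L ! i \<notin> filtration L i"
  by (auto simp: filtration_def in_set_conv_nth nth_eq_iff_index_eq)

lemma homology_basis_expand:
  assumes "homology_basis j X I z" "x \<in> cycles j X"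
  obtains r where "x - (\<Sum>k\<in>I. r k *\<^sub>C z k) \<in> boundaries j X"
  using assms by (auto simp: homology_basis_def)

text \<open>The subset \<open>J\<close> may be smaller than the index set of the basis; the missing coefficients are
  taken to be zero.\<close>

lemma homology_basis_indep:
  assumes "homology_basis j X I z" "J \<subseteq> I" "(\<Sum>k\<in>J. r k *\<^sub>C z k) \<in> boundaries j X" "k \<in> J"
  shows "r k = 0"
proof -
  have fin: "finite I" using assms by (simp add: homology_basis_def)
  define s where "s k = (if k \<in> J then r k else 0)" for k
  have "(\<Sum>k\<in>I. s k *\<^sub>C z k) = (\<Sum>k\<in>J. s k *\<^sub>C z k)"
    using assms(2) fin by (intro sum.mono_neutral_right) (auto simp: s_def)
  also have "\<dots> = (\<Sum>k\<in>J. r k *\<^sub>C z k)"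
    by (intro sum.cong) (auto simp: s_def)
  finally have "\<forall>k\<in>I. s k = 0"
    using assms(1,3) unfolding homology_basis_def by metis
  then have "s k = 0" using assms(2,4) by blast
  then show ?thesis using assms(4) by (simp add: s_def)
qed

lemma homology_basis_not_boundary:
  assumes "homology_basis j X I z" "k \<in> I"
  shows "z k \<notin> boundaries j X"
proof
  assume "z k \<in> boundaries j X"
  then have "(\<Sum>l\<in>{k}. (\<lambda>_. 1) l *\<^sub>C z l) \<in> boundaries j X" by simp
  from homology_basis_indep[OF assms(1) _ this, of k] assms(2) show False by simp
qed

text \<open>A face of the canonical filtration enters after its facets.\<close>

lemma face_boundary_in_cycles_filtration:
  fixes K :: "'a::linorder set set"
  assumes K: "simplicial_complex K" and L: "canonical_order K w L"
    and i: "i < length L" and c: "card (L ! i) = j + 2"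
  shows "(face_boundary (L ! i) :: 'a set \<Rightarrow> 'f::field) \<in> cycles j (filtration L i)"
proof (rule face_boundary_in_cycles)
  show "card (L ! i) = j + 2" using c by simp
  fix v assume v: "v \<in> L ! i"
  have sL: "set L = K" and ord: "\<forall>a < length L. \<forall>b < length L. L ! a \<subset> L ! b \<longrightarrow> a < b"
    using L unfolding canonical_order_def by blast+
  have "L ! i \<in> faces (j + 1) K"
    using sL nth_mem[OF i] c by (simp add: faces_def)
  then have "L ! i - {v} \<in> K" using v by (rule facet_in_complex[OF K])
  then obtain a where a: "a < length L" "L ! a = L ! i - {v}"
    using sL by (metis in_set_conv_nth)
  moreover have "L ! a \<subset> L ! i" using a v by auto
  ultimately have "a < i" using ord i by blast
  then show "L ! i - {v} \<in> filtration L i"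
    using a i unfolding filtration_def by (metis in_set_conv_nth length_take min_less_iff_conj nth_take)
qed

text \<open>The face that enters at step \<open>Suc i\<close> is \<open>L ! i\<close>. In the vanishing homology of \<open>K\<close> no class
  survives, and each bar ends with the entry of one face of the greedy acycle.\<close>

lemma death_indices_bij_betw:
  fixes K :: "'a::linorder set set" and z :: "nat \<Rightarrow> 'a set \<Rightarrow> 'f::field" and b :: "nat \<Rightarrow> enat"
  assumes K: "simplicial_complex K" and L: "canonical_order K w L"
    and bet: "betti TYPE('f) j K = 0"
    and ab: "\<And>k. k < n \<Longrightarrow> a k \<le> length L \<and> enat (a k) < b k \<and> (b k \<le> enat (length L) \<or> b k = \<infinity>)"
    and zb: "\<And>k i. k < n \<Longrightarrow> b k = enat i \<Longrightarrow> z k \<in> boundaries j (filtration L i)"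
    and H: "\<And>i. i \<le> length L \<Longrightarrow>
      homology_basis j (filtration L i) {k. k < n \<and> a k \<le> i \<and> enat i < b k} z"
  shows "\<forall>k<n. b k \<noteq> \<infinity>"
    and "bij_betw (\<lambda>k. L ! (the_enat (b k) - 1)) {..<n} (greedy_acycle TYPE('f) (j + 1) L)"
proof -
  have dL: "distinct L" and sL: "set L = K" using L unfolding canonical_order_def by blast+
  let ?B = "\<lambda>i. boundaries j (filtration L i) :: ('a set \<Rightarrow> 'f) set"
  let ?Z = "\<lambda>i. cycles j (filtration L i) :: ('a set \<Rightarrow> 'f) set"
  let ?I = "\<lambda>i. {k. k < n \<and> a k \<le> i \<and> enat i < b k}"
  have sB: "chain.subspace (?B i)" for i by (simp add: subspace_boundaries)
  show fin: "\<forall>k<n. b k \<noteq> \<infinity>"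
  proof (intro allI impI notI)
    fix k assume k: "k < n" "b k = \<infinity>"
    have N: "filtration L (length L) = K" by (simp add: filtration_def sL)
    have "k \<in> ?I (length L)" using k ab by auto
    then have "z k \<in> ?Z (length L)" "z k \<notin> ?B (length L)"
      using H[of "length L"] homology_basis_not_boundary[OF H[of "length L"]]
      by (auto simp: homology_basis_def)
    then show False using bet by (simp add: N betti_eq_0_iff[OF K])
  qed
  have step: "\<exists>i<length L. b k = enat (Suc i) \<and> k \<in> ?I i" if k: "k < n" for k
  proof -
    obtain i where i: "b k = enat i" using fin k by auto
    with ab[OF k] have "i \<noteq> 0" "i \<le> length L" "a k < i" by auto
    then show ?thesis using i k by (intro exI[of _ "i - 1"]) auto
  qed
  \<comment> \<open>A face outside the greedy acycle does not enlarge the space of boundaries, so no bar ends.\<close>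
  have dying: "L ! i \<in> greedy_acycle TYPE('f) (j + 1) L"
    if k: "k < n" "b k = enat (Suc i)" and i: "i < length L" for k i
  proof (rule ccontr)
    assume n: "L ! i \<notin> greedy_acycle TYPE('f) (j + 1) L"
    have "?B (Suc i) = ?B i"
    proof (cases "card (L ! i) = j + 2")
      case True
      then have "(face_boundary (L ! i) :: 'a set \<Rightarrow> 'f) \<in> ?B i"
        using n nth_in_greedy_acycle_iff[OF dL i] by blast
      then show ?thesis
        using True i by (simp add: boundaries_eq_span faces_filtration_Suc chain.span_redundant)
    next
      case False
      then show ?thesis
        using i by (intro boundaries_cong) (simp add: faces_filtration_Suc)
    qed
    moreover have "k \<in> ?I i" using step[OF k(1)] k by auto
    ultimately show False
      using zb[OF k] homology_basis_not_boundary[OF H[of i]] i by auto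
  qed
  show "bij_betw (\<lambda>k. L ! (the_enat (b k) - 1)) {..<n} (greedy_acycle TYPE('f) (j + 1) L)"
    unfolding bij_betw_def
  proof (intro conjI inj_onI equalityI subsetI)
    fix k l assume kl: "k \<in> {..<n}" "l \<in> {..<n}"
      and eq: "L ! (the_enat (b k) - 1) = L ! (the_enat (b l) - 1)"
    obtain i where i: "i < length L" "b k = enat (Suc i)" "k \<in> ?I i" using step kl by auto
    obtain i' where i': "i' < length L" "b l = enat (Suc i')" "l \<in> ?I i'" using step kl by auto
    have "i = i'" using eq i i' dL by (simp add: nth_eq_iff_index_eq)
    with i' have l: "b l = enat (Suc i)" "l \<in> ?I i" by auto
    have "card (L ! i) = j + 2"
      using dying[of k i] i nth_in_greedy_acycle_iff[OF dL i(1)] by auto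
    then have B: "?B (Suc i) =
        chain.span (insert (face_boundary (L ! i)) (face_boundary ` faces (j + 1) (filtration L i)))"
      using i by (simp add: boundaries_eq_span faces_filtration_Suc)
    have B0: "?B i = chain.span (face_boundary ` faces (j + 1) (filtration L i))"
      by (simp add: boundaries_eq_span)
    obtain r where r: "z k - r *\<^sub>C face_boundary (L ! i) \<in> ?B i"
      using zb[of k "Suc i"] i unfolding B B0 by (auto simp: chain.span_insert)
    obtain s where s: "z l - s *\<^sub>C face_boundary (L ! i) \<in> ?B i"
      using zb[of l "Suc i"] l unfolding B B0 by (auto simp: chain.span_insert)
    \<comment> \<open>Two bars ending together would both become multiples of \<open>\<partial>(L ! i)\<close> modulo the old
      boundaries, hence be dependent before.\<close>
    have rn: "r \<noteq> 0"
      using homology_basis_not_boundary[OF H[of i], of k] i r by auto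
    show "k = l"
    proof (rule ccontr)
      assume ne: "k \<noteq> l"
      define t where "t m = (if m = k then s else - r)" for m
      have "(\<Sum>m\<in>{k, l}. t m *\<^sub>C z m) =
          s *\<^sub>C (z k - r *\<^sub>C face_boundary (L ! i)) - r *\<^sub>C (z l - s *\<^sub>C face_boundary (L ! i))"
        using ne by (simp add: t_def chain_scale_def fun_eq_iff algebra_simps)
      also have "\<dots> \<in> ?B i"
        by (rule chain.subspace_diff[OF sB chain.subspace_scale[OF sB r] chain.subspace_scale[OF sB s]])
      finally have "t l = 0"
        using homology_basis_indep[OF H[of i], of "{k, l}" t l] i l by auto
      then show False using ne rn by (simp add: t_def)
    qed
  next
    fix \<sigma> assume "\<sigma> \<in> (\<lambda>k. L ! (the_enat (b k) - 1)) ` {..<n}"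
    then show "\<sigma> \<in> greedy_acycle TYPE('f) (j + 1) L"
      using step dying by fastforce
  next
    fix \<sigma> assume \<sigma>: "\<sigma> \<in> greedy_acycle TYPE('f) (j + 1) L"
    then obtain i where i: "i < length L" "\<sigma> = L ! i"
      by (auto simp: greedy_acycle_def chain.greedy_basis_def)
    have c: "card (L ! i) = j + 2" and nb: "(face_boundary (L ! i) :: 'a set \<Rightarrow> 'f) \<notin> ?B i"
      using \<sigma> i nth_in_greedy_acycle_iff[OF dL i(1)] by auto
    let ?y = "face_boundary (L ! i) :: 'a set \<Rightarrow> 'f"
    have "?y \<in> ?Z i"
      by (rule face_boundary_in_cycles_filtration[OF K L i(1) c])
    then obtain r where r: "?y - (\<Sum>k\<in>?I i. r k *\<^sub>C z k) \<in> ?B i"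
      using homology_basis_expand[OF H[of i]] i by auto
    have BB: "?B i \<subseteq> ?B (Suc i)" by (intro boundaries_mono filtration_mono) simp
    have y: "?y \<in> ?B (Suc i)"
      using i c by (auto simp: boundaries_eq_span faces_filtration_Suc intro!: chain.span_base)
    \<comment> \<open>If no bar ended, the representation of the cycle \<open>?y\<close> would be a relation between the
      surviving classes as soon as \<open>?y\<close> becomes a boundary.\<close>
    have "\<exists>k\<in>?I i. b k = enat (Suc i)"
    proof (rule ccontr)
      assume none: "\<not> (\<exists>k\<in>?I i. b k = enat (Suc i))"
      have *: "enat (Suc i) < b k" if "k \<in> ?I i" for k
      proof -
        have "eSuc (enat i) \<le> b k" using that by (simp add: ileI1)
        moreover have "b k \<noteq> enat (Suc i)" using none that by blast
        ultimately show ?thesis by (simp add: eSuc_enat)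
      qed
      have "?y - (?y - (\<Sum>k\<in>?I i. r k *\<^sub>C z k)) \<in> ?B (Suc i)"
        by (rule chain.subspace_diff[OF sB y subsetD[OF BB r]])
      then have S: "(\<Sum>k\<in>?I i. r k *\<^sub>C z k) \<in> ?B (Suc i)"
        by (simp only: diff_diff_eq2 add_diff_cancel_left')
      have sub: "?I i \<subseteq> ?I (Suc i)" using * by auto
      have "r k = 0" if "k \<in> ?I i" for k
        using homology_basis_indep[OF H[of "Suc i"] sub S that] i by simp
      then have "(\<Sum>k\<in>?I i. r k *\<^sub>C z k) = 0"
        by (intro sum.neutral ballI) (simp only: chain.scale_zero_left)
      with r nb show False by (simp only: diff_0_right)
    qed
    then obtain k where "k < n" "b k = enat (Suc i)" by auto
    then show "\<sigma> \<in> (\<lambda>k. L ! (the_enat (b k) - 1)) ` {..<n}"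
      using i by (intro image_eqI[of _ _ k]) auto
  qed
qed

text \<open>The face \<open>L ! i\<close> lies on a cycle of the faces up to it exactly if its boundary is spanned by
  the boundaries of earlier faces.\<close>

lemma cycle_through_iff:
  fixes L :: "'a::linorder set list"
  assumes L: "distinct L" and i: "i < length L" and c: "card (L ! i) = j + 2"
  shows "(\<exists>c \<in> cycles (j + 1) (filtration L (Suc i)). c (L ! i) \<noteq> (0::'f::field)) \<longleftrightarrow>
    (face_boundary (L ! i) :: 'a set \<Rightarrow> 'f) \<in> boundaries j (filtration L i)"
proof
  let ?F = "faces (j + 1) (filtration L i)" and ?y = "face_boundary (L ! i) :: 'a set \<Rightarrow> 'f"
  have F: "faces (j + 1) (filtration L (Suc i)) = insert (L ! i) ?F"
    using i c by (simp add: faces_filtration_Suc)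
  have n: "L ! i \<notin> ?F"
    using nth_notin_filtration[OF L i] by (simp add: faces_def)
  have fin: "finite ?F" by (simp add: finite_faces)
  assume "\<exists>c \<in> cycles (j + 1) (filtration L (Suc i)). c (L ! i) \<noteq> (0::'f)"
  then obtain c :: "'a set \<Rightarrow> 'f" where c: "c \<in> chains (j + 1) (filtration L (Suc i))"
      "boundary c = 0" "c (L ! i) \<noteq> 0"
    by (auto simp: cycles_def)
  let ?s = "\<Sum>\<sigma>\<in>?F. c \<sigma> *\<^sub>C face_boundary \<sigma> :: 'a set \<Rightarrow> 'f"
  have "?s \<in> chain.span (face_boundary ` ?F)"
    by (intro chain.span_sum chain.span_scale chain.span_base imageI)
  then have sB: "?s \<in> boundaries j (filtration L i)"
    by (simp add: boundaries_eq_span)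
  have 0: "c (L ! i) *\<^sub>C ?y + ?s = 0"
    using boundary_chain[OF finite_filtration c(1)] c(2) unfolding F sum.insert[OF fin n] by metis
  have "?y = (- inverse (c (L ! i))) *\<^sub>C ?s"
  proof
    fix \<tau>
    have "c (L ! i) * ?y \<tau> + ?s \<tau> = 0"
      using fun_cong[OF 0, of \<tau>] by (simp add: chain_scale_def)
    then show "?y \<tau> = ((- inverse (c (L ! i))) *\<^sub>C ?s) \<tau>"
      using c(3) by (simp add: chain_scale_def field_simps eq_neg_iff_add_eq_0)
  qed
  then show "?y \<in> boundaries j (filtration L i)"
    using chain.subspace_scale[OF subspace_boundaries[OF finite_filtration] sB] by metis
next
  let ?y = "face_boundary (L ! i) :: 'a set \<Rightarrow> 'f"
  assume "?y \<in> boundaries j (filtration L i)"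
  then obtain e where e: "e \<in> chains (j + 1) (filtration L i)" "?y = boundary e"
    by (auto simp: boundaries_def)
  let ?c = "face_chain (L ! i) + (- 1) *\<^sub>C e"
  have e0: "e (L ! i) = 0"
    using e(1) nth_notin_filtration[OF L i] by (auto simp: chains_def faces_def)
  have fc: "finite {\<sigma>. (face_chain (L ! i) :: 'a set \<Rightarrow> 'f) \<sigma> \<noteq> 0}"
    by (rule finite_subset[of _ "{L ! i}"]) (auto simp: face_chain_def split: if_splits)
  have e': "(- 1) *\<^sub>C e \<in> chains (j + 1) (filtration L i)"
    by (rule chain.subspace_scale[OF subspace_chains e(1)])
  have "boundary ?c = boundary (face_chain (L ! i)) + boundary ((- 1) *\<^sub>C e)"
    by (rule boundary_add[OF fc chains_finite_support[OF finite_filtration e']])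
  also have "\<dots> = ?y + (- 1) *\<^sub>C boundary e"
    by (simp only: boundary_face_chain boundary_scale[OF chains_finite_support[OF finite_filtration e(1)]])
  also have "\<dots> = 0"
    by (simp add: e(2)[symmetric] chain_scale_def fun_eq_iff)
  finally have b: "boundary ?c = 0" .
  have "face_chain (L ! i) \<in> chains (j + 1) (filtration L (Suc i))"
    using i c by (auto simp: chains_def face_chain_def filtration_Suc faces_def)
  moreover have "(- 1) *\<^sub>C e \<in> chains (j + 1) (filtration L (Suc i))"
    using e' chains_mono[OF filtration_mono[of i "Suc i" L]] by auto
  ultimately have "?c \<in> cycles (j + 1) (filtration L (Suc i))"
    using b chain.subspace_add[OF subspace_chains] by (auto simp only: cycles_def mem_Collect_eq)
  moreover have "?c (L ! i) \<noteq> 0"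
    using e0 by (simp add: chain_scale_def face_chain_def)
  ultimately show "\<exists>c \<in> cycles (j + 1) (filtration L (Suc i)). c (L ! i) \<noteq> (0::'f)" by blast
qed

lemma cycle_avoiding_last:
  assumes "i < length L" "c \<in> cycles j (filtration L (Suc i))" "c (L ! i) = 0"
  shows "c \<in> cycles j (filtration L i)"
  using assms by (auto simp: cycles_def chains_def filtration_Suc faces_def)

text \<open>Without faces of higher dimension there are no nonzero boundaries, so no bar ends, and each
  bar starts with the entry of a face of the top dimension outside the greedy acycle.\<close>

lemma birth_indices_bij_betw:
  fixes L :: "'a::linorder set list" and z :: "nat \<Rightarrow> 'a set \<Rightarrow> 'f::field" and b :: "nat \<Rightarrow> enat"
  assumes dL: "distinct L" and top: "faces (j + 2) (set L) = {}"
    and ab: "\<And>k. k < n \<Longrightarrow> a k \<le> length L \<and> enat (a k) < b k"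
    and za: "\<And>k. k < n \<Longrightarrow> z k \<in> cycles (j + 1) (filtration L (a k))"
    and zb: "\<And>k i. k < n \<Longrightarrow> b k = enat i \<Longrightarrow> z k \<in> boundaries (j + 1) (filtration L i)"
    and H: "\<And>i. i \<le> length L \<Longrightarrow>
      homology_basis (j + 1) (filtration L i) {k. k < n \<and> a k \<le> i \<and> enat i < b k} z"
  shows "bij_betw (\<lambda>k. L ! (a k - 1)) {..<n}
    (faces (j + 1) (set L) - greedy_acycle TYPE('f) (j + 1) L)"
proof -
  let ?Z = "\<lambda>i. cycles (j + 1) (filtration L i) :: ('a set \<Rightarrow> 'f) set"
  let ?I = "\<lambda>i. {k. k < n \<and> a k \<le> i}"
  have "faces (j + 2) (filtration L i) = {}" for i
    using top faces_filtration[of "j + 2" L i] by simp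
  then have B: "(boundaries (j + 1) (filtration L i) :: ('a set \<Rightarrow> 'f) set) = {0}" for i
    by (simp add: boundaries_eq_span)
  have inf: "b k = \<infinity>" if k: "k < n" for k
  proof (rule ccontr)
    assume "b k \<noteq> \<infinity>"
    then obtain i where "b k = enat i" by auto
    then have "z k \<in> boundaries (j + 1) (filtration L (a k))"
      using zb[OF k] unfolding B by blast
    then show False
      using homology_basis_not_boundary[OF H[of "a k"], of k] ab[OF k] k by auto
  qed
  then have I: "{k. k < n \<and> a k \<le> i \<and> enat i < b k} = ?I i" for i by auto
  have H': "homology_basis (j + 1) (filtration L i) (?I i) z" if "i \<le> length L" for i
    using H[OF that] unfolding I .
  have step: "\<exists>i<length L. a k = Suc i" if k: "k < n" for k
  proof (cases "a k")
    case 0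
    then have "z k = 0"
      using za[OF k] by (auto simp: cycles_def chains_def filtration_def faces_def)
    then have "z k \<in> boundaries (j + 1) (filtration L 0)" unfolding B by simp
    then show ?thesis
      using homology_basis_not_boundary[OF H'[of 0], of k] k 0 by auto
  qed (use ab[OF k] in auto)
  \<comment> \<open>The bars that start at step \<open>Suc i\<close> are independent modulo the cycles of step \<open>i\<close>.\<close>
  have new: "t m = 0"
    if i: "i < length L" and J: "J \<subseteq> {k. k < n \<and> a k = Suc i}" and m: "m \<in> J"
      and x: "(\<Sum>k\<in>J. t k *\<^sub>C z k) \<in> ?Z i" for t J m i
  proof -
    have finJ: "finite J" using J finite_subset[of J "{..<n}"] by auto
    obtain r where "(\<Sum>k\<in>J. t k *\<^sub>C z k) - (\<Sum>k\<in>?I i. r k *\<^sub>C z k) \<in> boundaries (j + 1) (filtration L i)"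
      using homology_basis_expand[OF H' x] i by auto
    then have r: "(\<Sum>k\<in>J. t k *\<^sub>C z k) - (\<Sum>k\<in>?I i. r k *\<^sub>C z k) = 0"
      unfolding B by blast
    define u where "u k = (if k \<in> J then t k else - r k)" for k
    have disj: "J \<inter> ?I i = {}" using J by auto
    then have "(\<Sum>k\<in>J \<union> ?I i. u k *\<^sub>C z k) = (\<Sum>k\<in>J. u k *\<^sub>C z k) + (\<Sum>k\<in>?I i. u k *\<^sub>C z k)"
      using finJ by (intro sum.union_disjoint) auto
    also have "(\<Sum>k\<in>J. u k *\<^sub>C z k) = (\<Sum>k\<in>J. t k *\<^sub>C z k)"
      by (intro sum.cong) (auto simp: u_def)
    also have "(\<Sum>k\<in>?I i. u k *\<^sub>C z k) = (\<Sum>k\<in>?I i. - (r k *\<^sub>C z k))"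
      using disj by (intro sum.cong) (auto simp: u_def chain_scale_def)
    also have "\<dots> = - (\<Sum>k\<in>?I i. r k *\<^sub>C z k)" by (rule sum_negf)
    finally have "(\<Sum>k\<in>J \<union> ?I i. u k *\<^sub>C z k) \<in> boundaries (j + 1) (filtration L (Suc i))"
      using r unfolding B by (simp only: diff_conv_add_uminus singleton_iff)
    then have "u m = 0"
      by (rule homology_basis_indep[OF H', rotated 2]) (use i J m in auto)
    then show "t m = 0" using m by (simp add: u_def)
  qed
  \<comment> \<open>So their cycles pass through the new face.\<close>
  have key: "z k (L ! i) \<noteq> 0" if k: "k < n" "a k = Suc i" and i: "i < length L" for k i
  proof
    assume 0: "z k (L ! i) = 0"
    have "z k \<in> ?Z (Suc i)"
      using za[OF k(1)] unfolding k(2) .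
    then have "z k \<in> ?Z i" using 0 by (rule cycle_avoiding_last[OF i])
    then have *: "(\<Sum>l\<in>{k}. (\<lambda>_. 1) l *\<^sub>C z l) \<in> ?Z i" by simp
    have "(1 :: 'f) = 0"
      by (rule new[OF i _ _ *, of k]) (use k in auto)
    then show False by simp
  qed
  show ?thesis
    unfolding bij_betw_def
  proof (intro conjI inj_onI equalityI subsetI)
    fix k l assume kl: "k \<in> {..<n}" "l \<in> {..<n}" and eq: "L ! (a k - 1) = L ! (a l - 1)"
    obtain i where i: "i < length L" "a k = Suc i" using step kl by auto
    obtain i' where i': "i' < length L" "a l = Suc i'" using step kl by auto
    have "i = i'" using eq i i' dL by (simp add: nth_eq_iff_index_eq)
    with i' have l: "a l = Suc i" by simp
    have zk: "z k \<in> ?Z (Suc i)" "z l \<in> ?Z (Suc i)"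
      using za[of k] za[of l] kl i l by auto
    have sZ: "chain.subspace (?Z (Suc i))" by (simp add: subspace_cycles)
    show "k = l"
    proof (rule ccontr)
      assume ne: "k \<noteq> l"
      \<comment> \<open>The combination in which the new face cancels is an old cycle.\<close>
      define t where "t m = (if m = k then z l (L ! i) else - z k (L ! i))" for m
      have s: "(\<Sum>m\<in>{k, l}. t m *\<^sub>C z m) = t k *\<^sub>C z k + t l *\<^sub>C z l"
        using ne by simp
      have "t k *\<^sub>C z k + t l *\<^sub>C z l \<in> ?Z (Suc i)"
        by (intro chain.subspace_add[OF sZ] chain.subspace_scale[OF sZ] zk)
      moreover have "(t k *\<^sub>C z k + t l *\<^sub>C z l) (L ! i) = 0"
        using ne by (simp add: t_def chain_scale_def)
      ultimately have "(\<Sum>m\<in>{k, l}. t m *\<^sub>C z m) \<in> ?Z i"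
        unfolding s by (rule cycle_avoiding_last[OF i(1)])
      from new[OF i(1) _ _ this, of l] have "t l = 0" using kl i l by auto
      then show False using ne key[of k i] kl i by (simp add: t_def)
    qed
  next
    fix \<sigma> assume "\<sigma> \<in> (\<lambda>k. L ! (a k - 1)) ` {..<n}"
    then obtain k i where k: "k < n" "a k = Suc i" "i < length L" "\<sigma> = L ! i"
      using step by fastforce
    have z: "z k \<in> ?Z (Suc i)" "z k (L ! i) \<noteq> 0" using za[of k] k key[of k i] by auto
    then have "L ! i \<in> faces (j + 1) (filtration L (Suc i))"
      by (auto simp: cycles_def chains_def)
    then have f: "L ! i \<in> faces (j + 1) (set L)" by (simp add: faces_filtration)
    then have c: "card (L ! i) = j + 2" by (simp add: faces_def)
    have "(face_boundary (L ! i) :: 'a set \<Rightarrow> 'f) \<in> boundaries j (filtration L i)"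
      using z by (intro iffD1[OF cycle_through_iff[OF dL k(3) c]]) blast
    then show "\<sigma> \<in> faces (j + 1) (set L) - greedy_acycle TYPE('f) (j + 1) L"
      using f nth_in_greedy_acycle_iff[OF dL k(3), where 'f = 'f] k(4) by blast
  next
    fix \<sigma> assume \<sigma>: "\<sigma> \<in> faces (j + 1) (set L) - greedy_acycle TYPE('f) (j + 1) L"
    then obtain i where i: "i < length L" "\<sigma> = L ! i"
      by (auto simp: faces_def in_set_conv_nth)
    have c: "card (L ! i) = j + 2" using \<sigma> i by (simp add: faces_def)
    have "(face_boundary (L ! i) :: 'a set \<Rightarrow> 'f) \<in> boundaries j (filtration L i)"
      using \<sigma> i c nth_in_greedy_acycle_iff[OF dL i(1), where 'f = 'f] by blast
    then obtain x :: "'a set \<Rightarrow> 'f" where x: "x \<in> ?Z (Suc i)" "x (L ! i) \<noteq> 0"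
      using cycle_through_iff[OF dL i(1) c, where 'f = 'f] by blast
    obtain r where "x - (\<Sum>k\<in>?I (Suc i). r k *\<^sub>C z k) \<in> boundaries (j + 1) (filtration L (Suc i))"
      using homology_basis_expand[OF H' x(1)] i by auto
    then have "x = (\<Sum>k\<in>?I (Suc i). r k *\<^sub>C z k)"
      unfolding B by (simp only: singleton_iff right_minus_eq)
    then have "(\<Sum>k\<in>?I (Suc i). r k * z k (L ! i)) \<noteq> 0"
      using x(2) by (simp add: chain_sum_apply chain_scale_def)
    then obtain k where k: "k < n" "a k \<le> Suc i" "z k (L ! i) \<noteq> 0"
      by (force elim: sum.not_neutral_contains_not_neutral)
    have "L ! i \<in> filtration L (a k)"
      using za[OF k(1)] k(3) by (auto simp: cycles_def chains_def faces_def)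
    then have "\<not> a k \<le> i"
      using filtration_mono[of "a k" i L] nth_notin_filtration[OF dL i(1)] by blast
    with k have "a k = Suc i" by simp
    with k i show "\<sigma> \<in> (\<lambda>k. L ! (a k - 1)) ` {..<n}"
      by (intro image_eqI[of _ _ k]) auto
  qed
qed


section \<open>Comparison with minimal spanning acycles\<close>

text \<open>The canonical order is sorted by weight, so the faces up to \<open>e\<close> are not heavier than \<open>e\<close>.\<close>

lemma greedy_acycle_sublevel:
  fixes L :: "'a::linorder set list"
  assumes L: "canonical_order K w L" and e: "e \<in> faces d K"
  shows "(face_boundary e :: 'a set \<Rightarrow> 'f::field) \<in>
    chain.span (face_boundary ` {m \<in> greedy_acycle TYPE('f) d L. w m \<le> w e})"
proof -
  have sL: "set L = K" and ord: "\<And>a b. a < length L \<Longrightarrow> b < length L \<Longrightarrow> w (L ! a) < w (L ! b) \<Longrightarrow> a < b"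
    using L unfolding canonical_order_def by blast+
  obtain i where i: "i < length L" "e = L ! i"
    using e sL by (auto simp: faces_def in_set_conv_nth)
  have "greedy_acycle TYPE('f) d L \<inter> set (take (Suc i) L) \<subseteq>
      {m \<in> greedy_acycle TYPE('f) d L. w m \<le> w e}"
  proof clarify
    fix m assume "m \<in> set (take (Suc i) L)"
    then obtain a where a: "a < Suc i" "a < length L" "m = L ! a"
      by (auto simp: in_set_conv_nth)
    then show "w m \<le> w e" using ord[OF i(1), of a] i by (cases "w m \<le> w e") auto
  qed
  then have "chain.span (face_boundary ` (greedy_acycle TYPE('f) d L \<inter> set (take (Suc i) L))) \<subseteq>
      (chain.span (face_boundary ` {m \<in> greedy_acycle TYPE('f) d L. w m \<le> w e}) :: ('a set \<Rightarrow> 'f) set)"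
    by (intro chain.span_mono image_mono)
  moreover have "(face_boundary e :: 'a set \<Rightarrow> 'f) \<in>
      chain.span (face_boundary ` (greedy_acycle TYPE('f) d L \<inter> set (take (Suc i) L)))"
    using chain.nth_in_span_greedy_basis[OF i(1), of "faces d (set L)"] e i sL
    by (simp add: greedy_acycle_def)
  ultimately show ?thesis by blast
qed

lemma image_mset_bij_betw:
  assumes "bij_betw g A B"
  shows "image_mset (\<lambda>k. f (g k)) (mset_set A) = image_mset f (mset_set B)"
proof -
  have "image_mset g (mset_set A) = mset_set B"
    using assms by (simp add: bij_betw_def image_mset_mset_set)
  moreover have "image_mset (\<lambda>k. f (g k)) (mset_set A) = image_mset f (image_mset g (mset_set A))"
    by (simp add: multiset.map_comp comp_def)
  ultimately show ?thesis by simp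
qed

theorem theorem1p3:
  fixes K :: "'a::linorder set set"
    and w :: "'a set \<Rightarrow> real"
    and d :: nat
    and L :: "'a set list"
    and Dgm Dgm' :: "(real \<times> ereal) multiset"
  assumes "d \<ge> 1"
    and "simplicial_complex K"
    and "has_dimension K d"
    and "mono_on K w"
    and "betti TYPE('f::field) (d - 1) K = 0"
    and "canonical_order K w L"
    and "is_persistence_diagram TYPE('f) (d - 1) w L Dgm"
    and "is_persistence_diagram TYPE('f) d w L Dgm'"
  shows "(\<exists>M. minimal_spanning_acycle TYPE('f) d K w M) \<and>
         (\<forall>M. minimal_spanning_acycle TYPE('f) d K w M \<longrightarrow>
            death_times Dgm = image_mset (\<lambda>\<sigma>. ereal (w \<sigma>)) (mset_set M) \<and>
            birth_times Dgm' = image_mset w (mset_set (faces d K - M)))"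
proof -
  obtain j where d: "d = j + 1" using \<open>d \<ge> 1\<close> by (metis add.commute le_Suc_ex)
  note K = \<open>simplicial_complex K\<close> and L = \<open>canonical_order K w L\<close>
  have bet: "betti TYPE('f) j K = 0" using assms(5) by (simp add: d)
  have dL: "distinct L" and sL: "set L = K" using L unfolding canonical_order_def by blast+
  let ?f = "face_boundary :: 'a set \<Rightarrow> 'a set \<Rightarrow> 'f"
  let ?F = "faces d K"
  define G where "G = greedy_acycle TYPE('f) d L"
  have finF: "finite ?F" by (rule finite_faces[OF finite_simplicial_complex[OF K]])
  note acycle = spanning_acycle_iff_basis_family[OF K \<open>d \<ge> 1\<close> assms(5)]
  have G: "chain.basis_family ?f ?F G"
    using chain.basis_family_greedy_basis[of ?f ?F L]
    by (simp add: G_def greedy_acycle_def sL faces_def Int_absorb2 subset_iff)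
  have deaths: "death_times Dgm = image_mset (\<lambda>\<sigma>. ereal (w \<sigma>)) (mset_set G)"
  proof -
    obtain n and a :: "nat \<Rightarrow> nat" and b :: "nat \<Rightarrow> enat" and z :: "nat \<Rightarrow> 'a set \<Rightarrow> 'f" where
      D: "Dgm = image_mset (diagram_point w L) (image_mset (\<lambda>k. (a k, b k)) (mset_set {..<n}))"
      and ab: "\<forall>k<n. a k \<le> length L \<and> enat (a k) < b k \<and> (b k \<le> enat (length L) \<or> b k = \<infinity>)"
      and zb: "\<forall>k<n. \<forall>i. b k = enat i \<longrightarrow> z k \<in> boundaries j (filtration L i)"
      and H: "\<forall>i\<le>length L. homology_basis j (filtration L i) {k. k < n \<and> a k \<le> i \<and> enat i < b k} z"
      using assms(7) unfolding is_persistence_diagram_def is_barcode_def d add_diff_cancel_right' by blast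
    have fin: "\<forall>k<n. b k \<noteq> \<infinity>"
      and bij: "bij_betw (\<lambda>k. L ! (the_enat (b k) - 1)) {..<n} G"
      using death_indices_bij_betw[OF K L bet, of n a b z] ab zb H by (auto simp: G_def d)
    have "death_times Dgm = image_mset (\<lambda>k. ereal (w (L ! (the_enat (b k) - 1)))) (mset_set {..<n})"
      unfolding death_times_def D multiset.map_comp
      using fin by (intro image_mset_cong) (auto simp: diagram_point_def entry_weight_def)
    also have "\<dots> = image_mset (\<lambda>\<sigma>. ereal (w \<sigma>)) (mset_set G)"
      by (rule image_mset_bij_betw[OF bij])
    finally show ?thesis .
  qed
  have births: "birth_times Dgm' = image_mset w (mset_set (?F - G))"
  proof -
    obtain n and a :: "nat \<Rightarrow> nat" and b :: "nat \<Rightarrow> enat" and z :: "nat \<Rightarrow> 'a set \<Rightarrow> 'f" where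
      D: "Dgm' = image_mset (diagram_point w L) (image_mset (\<lambda>k. (a k, b k)) (mset_set {..<n}))"
      and ab: "\<forall>k<n. a k \<le> length L \<and> enat (a k) < b k \<and> (b k \<le> enat (length L) \<or> b k = \<infinity>)"
      and za: "\<forall>k<n. z k \<in> cycles (j + 1) (filtration L (a k))"
      and zb: "\<forall>k<n. \<forall>i. b k = enat i \<longrightarrow> z k \<in> boundaries (j + 1) (filtration L i)"
      and H: "\<forall>i\<le>length L. homology_basis (j + 1) (filtration L i) {k. k < n \<and> a k \<le> i \<and> enat i < b k} z"
      using assms(8) unfolding is_persistence_diagram_def is_barcode_def d by blast
    have "faces (j + 2) (set L) = {}"
      using assms(3) by (force simp: has_dimension_def faces_def sL d)
    then have bij: "bij_betw (\<lambda>k. L ! (a k - 1)) {..<n} (?F - G)"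
      using birth_indices_bij_betw[OF dL, of j n a b z] ab za zb H by (simp add: G_def d sL)
    have "birth_times Dgm' = image_mset (\<lambda>k. w (L ! (a k - 1))) (mset_set {..<n})"
      unfolding birth_times_def D multiset.map_comp
      by (intro image_mset_cong) (auto simp: diagram_point_def entry_weight_def)
    also have "\<dots> = image_mset w (mset_set (?F - G))"
      by (rule image_mset_bij_betw[OF bij])
    finally show ?thesis .
  qed
  show ?thesis
  proof (intro conjI allI impI)
    let ?S = "{S. spanning_acycle TYPE('f) d K S}"
    have "?S \<subseteq> Pow ?F" by (auto simp: spanning_acycle_def)
    then have "finite ?S" using finF finite_subset by blast
    moreover have "G \<in> ?S" using G by (simp add: acycle)
    ultimately have "minimal_spanning_acycle TYPE('f) d K w (arg_min_on (sum w) ?S)"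
      using arg_min_if_finite(1)[of ?S "sum w"] arg_min_least[of ?S _ "sum w"]
      by (auto simp: minimal_spanning_acycle_def)
    then show "\<exists>M. minimal_spanning_acycle TYPE('f) d K w M" by blast
  next
    fix M assume M: "minimal_spanning_acycle TYPE('f) d K w M"
    then have bM: "chain.basis_family ?f ?F M"
      by (simp add: minimal_spanning_acycle_def acycle)
    have MF: "M \<subseteq> ?F" and GF: "G \<subseteq> ?F"
      using bM G by (auto simp: chain.basis_family_def)
    have fin: "finite M" "finite G" using MF GF finF finite_subset by blast+
    have eq: "image_mset w (mset_set M) = image_mset w (mset_set G)"
    proof (rule chain.weights_eq_of_sublevel_spanning[OF finF bM _ G])
      show "?f e \<in> chain.span (?f ` {m \<in> M. w m \<le> w e})" if "e \<in> ?F" for e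
        by (rule chain.minimal_basis_family_sublevel[OF bM fin(1) that])
          (use M in \<open>simp add: minimal_spanning_acycle_def acycle\<close>)
      show "?f e \<in> chain.span (?f ` {m \<in> G. w m \<le> w e})" if "e \<in> ?F" for e
        using greedy_acycle_sublevel[OF L that, where 'f = 'f] by (simp add: G_def)
    qed
    have "image_mset (\<lambda>\<sigma>. ereal (w \<sigma>)) (mset_set A) = image_mset ereal (image_mset w (mset_set A))" for A
      by (simp add: multiset.map_comp comp_def)
    then show "death_times Dgm = image_mset (\<lambda>\<sigma>. ereal (w \<sigma>)) (mset_set M)"
      using deaths eq by metis
    have "image_mset w (mset_set (?F - A)) = image_mset w (mset_set ?F) - image_mset w (mset_set A)"
      if "A \<subseteq> ?F" "finite A" for A
      using that finF by (simp add: mset_set_Diff image_mset_Diff subset_imp_msubset_mset_set)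
    then show "birth_times Dgm' = image_mset w (mset_set (?F - M))"
      using births eq MF GF fin by metis
  qed
qed

end
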